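(* Let $d\in\mathbb{N}$ and let $N\ge 2$ be an integer. Let $(p_j)_{j=1}^N$ be either a randomly shifted and jittered rank-1 lattice (RSJ rank-1 lattice) in $[0,1)^d$, in which case $N$ is assumed to be prime, or a Latin hypercube sampling (LHS) in $[0,1)^d$. Then for all $Q,R\in\mathcal{C}_1^d$, $$\mathbf{P}(p_1\in Q,\ p_2\in R)\le \mathbf{P}(p_1\in Q)\,\mathbf{P}(p_2\in R),$$ that is, RSJ rank-1 lattices and Latin hypercube sampling are pairwise negatively dependent. Moreover, RSJ rank-1 lattices and LHS are coordinatewise independent NQD sampling schemes.
   Context: Boxes. $\mathcal{C}_1^d=\{[x,1)\,:\,x\in[0,1)^d\}$, where $[x,1)=\prod_{i=1}^d[x^{(i)},1)$. The coordinates of a point $p_j$ are written $p_j=(p_j^{(1)},\dots,p_j^{(d)})$. Sampling scheme. A randomized point set $(p_j)_{j=1}^N$ is a sampling scheme if every $p_j$ is uniformly distributed in $[0,1)^d$ and the vector $(p_1,\dots,p_N)$ is exchangeable (its law is invariant under all permutations of the indices). It is pairwise negatively dependent if $\mathbf{P}(p_1\in Q,p_2\in R)\le\mathbf{P}(p_1\in Q)\mathbf{P}(p_2\in R)$ for all $Q,R\in\mathcal{C}_1^d$. It is a coordinatewise independent NQD sampling scheme if the pairs $(p_1^{(i)},p_2^{(i)})$, $i=1,\dots,d$, are independent and for every $i\in\{1,\dots,d\}$ and all $q,r\in[0,1)$ one has $\mathbf{P}(p_1^{(i)}\in[q,1),\,p_2^{(i)}\in[r,1))\le\mathbf{P}(p_1^{(i)}\in[q,1))\,\mathbf{P}(p_2^{(i)}\in[r,1))$.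 RSJ rank-1 lattice. Let $N$ be prime, $\mathbb{F}=\{0,1,\dots,N-1\}$, $\mathbb{F}^*=\mathbb{F}\setminus\{0\}$, $\widetilde{\mathbb{F}}=\frac1N\mathbb{F}$, $\widetilde{\mathbb{F}}^*=\frac1N\mathbb{F}^*$. Let $g$ be uniformly distributed on $(\widetilde{\mathbb{F}}^* )^d$, $S$ uniformly distributed on $\widetilde{\mathbb{F}}^d$, $J_1,\dots,J_N$ each uniformly distributed on $[0,\frac1N)^d$, and $\pi$ a uniformly chosen permutation of $\{1,\dots,N\}$, all of these random variables being independent. Put $y_j=(j-1)g \bmod 1$ and $p_j=y_{\pi(j)}+S+J_j \bmod 1$, $j=1,\dots,N$ (all operations componentwise modulo 1). Then $(p_j)_{j=1}^N$ is called an RSJ rank-1 lattice. Latin hypercube sampling. Let $\pi_1,\dots,\pi_d$ be independent uniformly chosen permutations of $\{1,\dots,N\}$ and let $U_j^{(i)}$, $i=1,\dots,d$, $j=1,\dots,N$, be independent random variables uniformly distributed on $[0,1)$, independent also of the permutations. The LHS $(p_j)_{j=1}^N$ is given by $p_j^{(i)}=\frac{\pi_i(j)-U_j^{(i)}}{N}$ (these points lie in $[0,1)^d$ almost surely). *)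

theory Defs
  imports "HOL-Probability.Probability" "HOL-Combinatorics.Permutations"
begin

text \<open>
  Points of \<open>[0,1)\<^sup>d\<close> are vectors of type \<open>real ^ 'd\<close> with \<open>d = CARD('d)\<close>, so the coordinates are
  indexed by the finite type \<open>'d\<close>. A randomized point set of size \<open>N\<close> on a probability space \<open>M\<close> is a
  family \<open>p :: nat \<Rightarrow> 'a \<Rightarrow> real ^ 'd\<close> of which only the members with index in \<open>{1..N}\<close> matter.
\<close>

definition cube :: "real \<Rightarrow> (real ^ 'd::finite) set" where
  "cube a = {x. \<forall>i. 0 \<le> x $ i \<and> x $ i < a}"

definition boxes_at_one :: "(real ^ 'd::finite) set set" where
  "boxes_at_one = {{y. \<forall>i. x $ i \<le> y $ i \<and> y $ i < 1} | x. x \<in> cube 1}"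

definition uniform_on :: "'a measure \<Rightarrow> ('a \<Rightarrow> 'b::euclidean_space) \<Rightarrow> 'b set \<Rightarrow> bool" where
  "uniform_on M X A \<longleftrightarrow> X \<in> borel_measurable M \<and> distr M borel X = uniform_measure lborel A"

text \<open>The discrete uniform law; \<open>L\<close> supplies the \<open>\<sigma>\<close>-algebra on the value space and is assumed to
  contain the singletons of \<open>A\<close> (below it is \<open>borel\<close> or \<open>count_space UNIV\<close>).\<close>

definition uniform_on_finite ::
    "'a measure \<Rightarrow> 'b measure \<Rightarrow> ('a \<Rightarrow> 'b) \<Rightarrow> 'b set \<Rightarrow> bool" where
  "uniform_on_finite M L X A \<longleftrightarrow> finite A \<and> A \<noteq> {} \<and> X \<in> measurable M L \<and>
     (\<forall>a\<in>A. \<P>(\<omega> in M. X \<omega> = a) = 1 / real (card A))"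

text \<open>The \<open>\<sigma>\<close>-algebra generated by \<open>X\<close>. The constant \<open>prob_space.indep_vars\<close> is independence of these
  families, but needs all variables to have the same value type; \<open>prob_space.indep_sets\<close> on the
  generated \<open>\<sigma>\<close>-algebras also covers vectors, reals and permutations together.\<close>

definition generated_events :: "'a measure \<Rightarrow> 'b measure \<Rightarrow> ('a \<Rightarrow> 'b) \<Rightarrow> 'a set set" where
  "generated_events M L X = {X -` A \<inter> space M | A. A \<in> sets L}"

definition exchangeable :: "'a measure \<Rightarrow> nat \<Rightarrow> (nat \<Rightarrow> 'a \<Rightarrow> real ^ 'd::finite) \<Rightarrow> bool" where
  "exchangeable M N p \<longleftrightarrow>
     (\<forall>\<sigma>. \<sigma> permutes {1..N} \<longrightarrow>
        distr M (Pi\<^sub>M {1..N} (\<lambda>_. borel)) (\<lambda>\<omega>. \<lambda>j\<in>{1..N}. p (\<sigma> j) \<omega>) =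
        distr M (Pi\<^sub>M {1..N} (\<lambda>_. borel)) (\<lambda>\<omega>. \<lambda>j\<in>{1..N}. p j \<omega>))"

definition sampling_scheme :: "'a measure \<Rightarrow> nat \<Rightarrow> (nat \<Rightarrow> 'a \<Rightarrow> real ^ 'd::finite) \<Rightarrow> bool" where
  "sampling_scheme M N p \<longleftrightarrow> (\<forall>j\<in>{1..N}. uniform_on M (p j) (cube 1)) \<and> exchangeable M N p"

definition pairwise_negatively_dependent ::
    "'a measure \<Rightarrow> nat \<Rightarrow> (nat \<Rightarrow> 'a \<Rightarrow> real ^ 'd::finite) \<Rightarrow> bool" where
  "pairwise_negatively_dependent M N p \<longleftrightarrow> sampling_scheme M N p \<and>
     (\<forall>Q\<in>boxes_at_one. \<forall>R\<in>boxes_at_one.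
        \<P>(\<omega> in M. p 1 \<omega> \<in> Q \<and> p 2 \<omega> \<in> R)
          \<le> \<P>(\<omega> in M. p 1 \<omega> \<in> Q) * \<P>(\<omega> in M. p 2 \<omega> \<in> R))"

definition coordinatewise_independent_NQD ::
    "'a measure \<Rightarrow> nat \<Rightarrow> (nat \<Rightarrow> 'a \<Rightarrow> real ^ 'd::finite) \<Rightarrow> bool" where
  "coordinatewise_independent_NQD M N p \<longleftrightarrow> sampling_scheme M N p \<and>
     prob_space.indep_vars M (\<lambda>_. borel \<Otimes>\<^sub>M borel) (\<lambda>i \<omega>. (p 1 \<omega> $ i, p 2 \<omega> $ i)) UNIV \<and>
     (\<forall>i. \<forall>q\<in>{0..<1}. \<forall>r\<in>{0..<1}.
        \<P>(\<omega> in M. p 1 \<omega> $ i \<in> {q..<1} \<and> p 2 \<omega> $ i \<in> {r..<1})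
          \<le> \<P>(\<omega> in M. p 1 \<omega> $ i \<in> {q..<1}) * \<P>(\<omega> in M. p 2 \<omega> $ i \<in> {r..<1}))"

definition mod_one :: "real ^ 'd::finite \<Rightarrow> real ^ 'd" where
  "mod_one x = (\<chi> i. frac (x $ i))"

definition grid :: "nat \<Rightarrow> (real ^ 'd::finite) set" where
  "grid N = {x. \<forall>i. \<exists>k\<in>{0..<N}. x $ i = real k / real N}"

definition grid_nonzero :: "nat \<Rightarrow> (real ^ 'd::finite) set" where
  "grid_nonzero N = {x. \<forall>i. \<exists>k\<in>{1..<N}. x $ i = real k / real N}"

datatype rsj_index = Generator | Shift | Jitter nat | Permutation

definition is_RSJ_rank1_lattice ::
    "'a measure \<Rightarrow> nat \<Rightarrow> (nat \<Rightarrow> 'a \<Rightarrow> real ^ 'd::finite) \<Rightarrow> bool" where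
  "is_RSJ_rank1_lattice M N p \<longleftrightarrow>
     (\<exists>(g :: 'a \<Rightarrow> real ^ 'd) (S :: 'a \<Rightarrow> real ^ 'd) (J :: nat \<Rightarrow> 'a \<Rightarrow> real ^ 'd)
       (\<pi> :: 'a \<Rightarrow> nat \<Rightarrow> nat).
        uniform_on_finite M borel g (grid_nonzero N) \<and>
        uniform_on_finite M borel S (grid N) \<and>
        (\<forall>j\<in>{1..N}. uniform_on M (J j) (cube (1 / real N))) \<and>
        uniform_on_finite M (count_space UNIV) \<pi> {\<sigma>. \<sigma> permutes {1..N}} \<and>
        prob_space.indep_sets M
          (\<lambda>k. case k of
                 Generator \<Rightarrow> generated_events M borel g
               | Shift \<Rightarrow> generated_events M borel S
               | Jitter j \<Rightarrow> generated_events M borel (J j)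
               | Permutation \<Rightarrow> generated_events M (count_space UNIV) \<pi>)
          ({Generator, Shift, Permutation} \<union> Jitter ` {1..N}) \<and>
        (\<forall>j\<in>{1..N}. \<forall>\<omega>\<in>space M.
           p j \<omega> = mod_one (mod_one ((real (\<pi> \<omega> j) - 1) *\<^sub>R g \<omega>) + S \<omega> + J j \<omega>)))"

datatype 'd lhs_index = Coordinate_Permutation 'd | Offset nat 'd

definition is_latin_hypercube_sampling ::
    "'a measure \<Rightarrow> nat \<Rightarrow> (nat \<Rightarrow> 'a \<Rightarrow> real ^ 'd::finite) \<Rightarrow> bool" where
  "is_latin_hypercube_sampling M N p \<longleftrightarrow>
     (\<exists>(\<pi> :: 'd \<Rightarrow> 'a \<Rightarrow> nat \<Rightarrow> nat) (U :: nat \<Rightarrow> 'd \<Rightarrow> 'a \<Rightarrow> real).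
        (\<forall>i. uniform_on_finite M (count_space UNIV) (\<pi> i) {\<sigma>. \<sigma> permutes {1..N}}) \<and>
        (\<forall>j\<in>{1..N}. \<forall>i. uniform_on M (U j i) {0..<1}) \<and>
        prob_space.indep_sets M
          (\<lambda>k. case k of
                 Coordinate_Permutation i \<Rightarrow> generated_events M (count_space UNIV) (\<pi> i)
               | Offset j i \<Rightarrow> generated_events M borel (U j i))
          (range Coordinate_Permutation \<union> {Offset j i | j i. j \<in> {1..N}}) \<and>
        (\<forall>j\<in>{1..N}. \<forall>\<omega>\<in>space M. \<forall>i.
           p j \<omega> $ i = (real (\<pi> i \<omega> j) - U j i \<omega>) / real N))"

end

theory Submission
  imports Defs
begin

text \<open>
  Both constructions have the same shape. Cut \<open>[0,1)\<^sup>d\<close> into \<open>N\<^sup>d\<close> congruent half-open cells. A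
  randomly chosen \<^emph>\<open>configuration\<close> \<open>a\<close>, uniform on a finite set \<open>A\<close>, assigns to each index \<open>j\<close> a
  cell \<open>c a j\<close>; given \<open>a\<close>, the points are independent and each is uniform in its own cell. For the
  lattice a configuration is a permutation together with a generator and a shift, and the uniformity
  inside the cells comes from the jitter; for Latin hypercube sampling a configuration is one
  permutation per coordinate, and the uniformity comes from the offsets. The locale \<open>cell_design\<close>
  records this law on product sets together with two combinatorial facts about \<open>A\<close> and \<open>c\<close>.

  \<^item> \<open>symmetric\<close>: permuting the indices amounts to permuting the configurations. This gives
    exchangeability.
  \<^item> \<open>distinct_pairs\<close>: in each coordinate the cells of the first two points form a uniformly
    distributed ordered pair of \<^emph>\<open>distinct\<close> elements of \<open>{0..<N}\<close>, independently over the coordinates.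
    For the lattice this holds for every fixed permutation, because for distinct residues \<open>m\<close> and \<open>n\<close>
    modulo a prime, \<open>(k, s) \<mapsto> (m k + s, n k + s)\<close> is a bijection from the pairs with \<open>k \<noteq> 0\<close> onto
    the pairs of distinct residues (\<open>lattice_pair_bij\<close>). For Latin hypercube sampling it follows from
    the symmetry of the group of permutations (\<open>sum_permutations_pair\<close>).

  Everything else is a consequence. A coordinate of a point is uniform on \<open>[0,1)\<close>, and
  the pairs formed by the \<open>i\<close>-th coordinates of the first two points are independent.
  Let \<open>a\<^sub>k\<close> and \<open>b\<^sub>k\<close> be the conditional probabilities that a
  point uniform in cell \<open>k\<close> of \<open>[0,1)\<close> lies in \<open>[q,1)\<close> and in
  \<open>[r,1)\<close>. Then the probability that the two \<open>i\<close>-th coordinates lie in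
  \<open>[q,1)\<close> and \<open>[r,1)\<close> is the mean of \<open>a\<^sub>x * b\<^sub>y\<close>
  over \<open>x \<noteq> y\<close>. Both sequences are nondecreasing in \<open>k\<close>, so by
  Chebyshev's sum inequality the diagonal terms left out are on average at least as large as the
  product of the means, and the mean over \<open>x \<noteq> y\<close> is at most \<open>(1 - q) * (1
  - r)\<close> (\<open>distinct_pair_mean_tail_le\<close>). This is the NQD inequality for one
  coordinate, and multiplying it over the independent coordinates gives pairwise negative
  dependence.
\<close>

section \<open>Product sets and Lebesgue measure on vectors\<close>

lemma borel_measurable_vec_iff:
  fixes f :: "'a \<Rightarrow> real ^ 'n::finite"
  shows "f \<in> borel_measurable M \<longleftrightarrow> (\<forall>i. (\<lambda>x. f x $ i) \<in> borel_measurable M)"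
proof -
  have "f \<in> borel_measurable M \<longleftrightarrow> (\<forall>b\<in>Basis. (\<lambda>x. f x \<bullet> b) \<in> borel_measurable M)"
    by (rule borel_measurable_euclidean_space)
  also have "\<dots> \<longleftrightarrow> (\<forall>i. (\<lambda>x. f x $ i) \<in> borel_measurable M)"
    by (auto simp: Basis_vec_def inner_axis)
  finally show ?thesis .
qed

text \<open>Lebesgue measure on vectors is characterised by its values on open boxes, and there the product
  measure agrees with it. This makes the volume of products of arbitrary Borel sets available.\<close>
lemma lborel_vec: "distr (Pi\<^sub>M UNIV (\<lambda>_. lborel)) borel vec_lambda = (lborel :: (real ^ 'n::finite) measure)"
proof (rule lborel_eqI[symmetric])
  interpret product_sigma_finite "\<lambda>_::'n. lborel :: real measure"
    by standard
  have meas: "vec_lambda \<in> borel_measurable (Pi\<^sub>M UNIV (\<lambda>_::'n. lborel :: real measure))"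
    by (subst borel_measurable_vec_iff) simp
  fix l u :: "real ^ 'n"
  assume le: "\<And>b. b \<in> Basis \<Longrightarrow> l \<bullet> b \<le> u \<bullet> b"
  have le': "l $ i \<le> u $ i" for i
    using le[of "axis i 1"] by (auto simp: Basis_vec_def inner_axis)
  have "vec_lambda -` box l u \<inter> space (Pi\<^sub>M UNIV (\<lambda>_::'n. lborel :: real measure))
      = Pi\<^sub>E UNIV (\<lambda>i. {l $ i <..< u $ i})"
    by (auto simp: box_def Basis_vec_def inner_axis space_PiM PiE_def Pi_def extensional_def)
  then have "emeasure (distr (Pi\<^sub>M UNIV (\<lambda>_. lborel)) borel vec_lambda) (box l u)
      = (\<Prod>i\<in>UNIV. ennreal (u $ i - l $ i))"
    by (simp add: emeasure_distr[OF meas] emeasure_PiM le')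
  also have "\<dots> = ennreal (\<Prod>i\<in>UNIV. u $ i - l $ i)"
    by (simp add: prod_ennreal le')
  also have "(\<Prod>i\<in>UNIV. u $ i - l $ i) = (\<Prod>b\<in>Basis. (u - l) \<bullet> b)"
  proof -
    have "(Basis :: (real ^ 'n) set) = (\<lambda>i. axis i 1) ` UNIV"
      by (auto simp: Basis_vec_def)
    moreover have "inj (\<lambda>i::'n. axis i (1::real))"
      by (auto simp: inj_on_def axis_eq_axis)
    ultimately show ?thesis
      using prod.reindex[of "\<lambda>i. axis i 1" UNIV "\<lambda>b. (u - l) \<bullet> b"]
      by (simp add: comp_def inner_axis)
  qed
  finally show "emeasure (distr (Pi\<^sub>M UNIV (\<lambda>_. lborel)) borel vec_lambda) (box l u)
      = (\<Prod>b\<in>Basis. (u - l) \<bullet> b)" .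
qed simp

lemma sets_product_box:
  fixes B :: "'n::finite \<Rightarrow> real set"
  assumes "\<And>i. B i \<in> sets borel"
  shows "{x :: real ^ 'n. \<forall>i. x $ i \<in> B i} \<in> sets borel"
proof -
  note assms[measurable]
  have "Measurable.pred borel (\<lambda>x :: real ^ 'n. \<forall>i. x $ i \<in> B i)"
    by measurable
  then show ?thesis by (simp add: pred_def)
qed

lemma emeasure_lborel_product_box:
  fixes B :: "'n::finite \<Rightarrow> real set"
  assumes B: "\<And>i. B i \<in> sets borel"
  shows "emeasure lborel {x :: real ^ 'n. \<forall>i. x $ i \<in> B i} = (\<Prod>i\<in>UNIV. emeasure lborel (B i))"
proof -
  interpret product_sigma_finite "\<lambda>_::'n. lborel :: real measure"
    by standard
  have meas: "vec_lambda \<in> borel_measurable (Pi\<^sub>M UNIV (\<lambda>_::'n. lborel :: real measure))"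
    by (subst borel_measurable_vec_iff) simp
  have "vec_lambda -` {x. \<forall>i. x $ i \<in> B i} \<inter> space (Pi\<^sub>M UNIV (\<lambda>_::'n. lborel :: real measure))
      = Pi\<^sub>E UNIV B"
    by (auto simp: space_PiM PiE_def Pi_def extensional_def)
  then show ?thesis
    by (subst lborel_vec[symmetric])
       (simp add: emeasure_distr[OF meas] sets_product_box B emeasure_PiM)
qed

lemma emeasure_uniform_cube:
  fixes B :: "'n::finite \<Rightarrow> real set"
  assumes a: "0 < a" and B: "\<And>i. B i \<in> sets borel"
  shows "emeasure (uniform_measure lborel (cube a)) {x :: real ^ 'n. \<forall>i. x $ i \<in> B i}
    = ennreal (\<Prod>i\<in>UNIV. measure lborel (B i \<inter> {0..<a}) / a)"
proof -
  have box: "emeasure lborel {x :: real ^ 'n. \<forall>i. x $ i \<in> C i \<inter> {0..<a}}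
      = ennreal (\<Prod>i\<in>UNIV. measure lborel (C i \<inter> {0..<a}))"
    if C: "\<And>i. C i \<in> sets borel" for C :: "'n \<Rightarrow> real set"
  proof -
    have "emeasure lborel (C i \<inter> {0..<a}) = measure lborel (C i \<inter> {0..<a})" for i
    proof -
      have "emeasure lborel (C i \<inter> {0..<a}) \<le> emeasure lborel {0..<a}"
        using C by (intro emeasure_mono) auto
      then show ?thesis
        using a by (intro emeasure_eq_ennreal_measure) (auto simp: top_unique)
    qed
    then show ?thesis
      using C emeasure_lborel_product_box[of "\<lambda>i. C i \<inter> {0..<a}"] by (simp add: prod_ennreal del: Int_iff)
  qed
  have cube: "cube a = {x :: real ^ 'n. \<forall>i. x $ i \<in> UNIV \<inter> {0..<a}}"
    by (auto simp: cube_def)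
  have cube_sets: "(cube a :: (real ^ 'n) set) \<in> sets borel"
    unfolding cube by (rule sets_product_box) simp
  have volume: "emeasure lborel (cube a :: (real ^ 'n) set) = ennreal (a ^ CARD('n))"
    using box[of "\<lambda>_. UNIV"] a unfolding cube by simp
  have inter: "cube a \<inter> {x :: real ^ 'n. \<forall>i. x $ i \<in> B i} = {x. \<forall>i. x $ i \<in> B i \<inter> {0..<a}}"
    by (auto simp: cube_def)
  have "emeasure (uniform_measure lborel (cube a)) {x :: real ^ 'n. \<forall>i. x $ i \<in> B i}
      = ennreal (\<Prod>i\<in>UNIV. measure lborel (B i \<inter> {0..<a})) / ennreal (a ^ CARD('n))"
    using cube_sets B
    by (subst emeasure_uniform_measure) (simp_all only: sets_lborel sets_product_box inter volume box)
  also have "\<dots> = ennreal (\<Prod>i\<in>UNIV. measure lborel (B i \<inter> {0..<a}) / a)"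
    using a by (subst divide_ennreal) (auto intro: prod_nonneg simp: prod_dividef)
  finally show ?thesis .
qed

text \<open>Products of Borel sets of reals determine a finite measure on vectors: transport it to the product
  space of the coordinates, use uniqueness there, and transport it back.\<close>
lemma measure_eqI_vec:
  fixes \<mu> \<nu> :: "(real ^ 'n::finite) measure"
  assumes "finite_measure \<mu>" and sets: "sets \<mu> = sets borel" "sets \<nu> = sets borel"
    and eq: "\<And>B. (\<And>i. B i \<in> sets borel) \<Longrightarrow>
      emeasure \<mu> {x. \<forall>i. x $ i \<in> B i} = emeasure \<nu> {x. \<forall>i. x $ i \<in> B i}"
  shows "\<mu> = \<nu>"
proof -
  interpret finite_measure \<mu> by fact
  define T where "T \<rho> = distr \<rho> (Pi\<^sub>M UNIV (\<lambda>_. borel)) (\<lambda>x :: real ^ 'n. \<lambda>i\<in>UNIV. x $ i)"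
    for \<rho> :: "(real ^ 'n) measure"
  have meas: "(\<lambda>x :: real ^ 'n. \<lambda>i\<in>UNIV. x $ i) \<in> measurable borel (Pi\<^sub>M UNIV (\<lambda>_. borel))"
    by (rule measurable_restrict) simp
  have vec: "vec_lambda \<in> borel_measurable (Pi\<^sub>M UNIV (\<lambda>_::'n. borel :: real measure))"
    by (subst borel_measurable_vec_iff) simp
  have box: "emeasure (T \<rho>) (Pi\<^sub>E UNIV B) = emeasure \<rho> {x. \<forall>i. x $ i \<in> B i}"
    if "sets \<rho> = sets borel" "\<And>i. B i \<in> sets borel" for \<rho> B
  proof -
    have "(\<lambda>x :: real ^ 'n. \<lambda>i\<in>UNIV. x $ i) -` Pi\<^sub>E UNIV B \<inter> space \<rho> = {x. \<forall>i. x $ i \<in> B i}"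
      using sets_eq_imp_space_eq[OF that(1)] by auto
    then show ?thesis
      using that meas unfolding T_def
      by (subst emeasure_distr) (auto simp: measurable_cong_sets[OF that(1) refl] intro!: sets_PiM_I_finite)
  qed
  have inv: "distr (T \<rho>) borel vec_lambda = \<rho>" if "sets \<rho> = sets borel" for \<rho>
    unfolding T_def using that meas vec
    by (subst distr_distr) (auto simp: measurable_cong_sets[OF that refl] comp_def restrict_UNIV intro: distr_id2)
  have "T \<mu> = T \<nu>"
  proof (rule measure_eqI_PiM_finite[where I = UNIV and M = "\<lambda>_. borel" and A = "\<lambda>_. Pi\<^sub>E UNIV (\<lambda>_. UNIV)"])
    show "range (\<lambda>_. Pi\<^sub>E UNIV (\<lambda>_. UNIV)) \<subseteq> prod_algebra (UNIV :: 'n set) (\<lambda>_. borel :: real measure)"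
      by (rule image_subsetI, rule prod_algebraI_finite) auto
    show "emeasure (T \<mu>) (Pi\<^sub>E UNIV (\<lambda>_. UNIV)) \<noteq> \<infinity>" for i :: nat
      by (subst box) (auto simp: sets)
  qed (auto simp: box sets eq space_PiM, auto simp: T_def)
  then show ?thesis
    using inv sets by metis
qed

text \<open>The same argument for families of vectors, flattened to real families over \<open>J \<times> UNIV\<close>. It
  reduces exchangeability to probabilities of events constraining single coordinates of points.\<close>
lemma measure_eqI_PiM_vec:
  fixes \<mu> \<nu> :: "(nat \<Rightarrow> real ^ 'n::finite) measure"
  assumes "finite_measure \<mu>" and "finite J"
    and sets: "sets \<mu> = sets (Pi\<^sub>M J (\<lambda>_. borel))" "sets \<nu> = sets (Pi\<^sub>M J (\<lambda>_. borel))"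
    and eq: "\<And>B. (\<And>j i. B j i \<in> sets borel) \<Longrightarrow>
      emeasure \<mu> (\<Pi>\<^sub>E j\<in>J. {x. \<forall>i. x $ i \<in> B j i}) = emeasure \<nu> (\<Pi>\<^sub>E j\<in>J. {x. \<forall>i. x $ i \<in> B j i})"
  shows "\<mu> = \<nu>"
proof -
  interpret finite_measure \<mu> by fact
  let ?P = "Pi\<^sub>M J (\<lambda>_. borel :: (real ^ 'n) measure)"
  let ?K = "J \<times> (UNIV :: 'n set)"
  let ?Q = "Pi\<^sub>M ?K (\<lambda>_. borel :: real measure)"
  define f where "f = (\<lambda>x :: nat \<Rightarrow> real ^ 'n. \<lambda>(j, i)\<in>?K. x j $ i)"
  define h where "h = (\<lambda>y :: nat \<times> 'n \<Rightarrow> real. \<lambda>j\<in>J. \<chi> i. y (j, i))"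
  have f: "f \<in> measurable ?P ?Q"
    unfolding f_def
  proof (rule measurable_restrict)
    fix k assume "k \<in> ?K"
    then have "(\<lambda>x. x (fst k)) \<in> measurable ?P borel"
      by (intro measurable_component_singleton) auto
    then have "(\<lambda>x. x (fst k) $ snd k) \<in> borel_measurable ?P"
      by (simp add: borel_measurable_vec_iff)
    then show "(\<lambda>x. case k of (j, i) \<Rightarrow> x j $ i) \<in> borel_measurable ?P"
      by (simp add: split_beta)
  qed
  have h: "h \<in> measurable ?Q ?P"
    unfolding h_def
  proof (rule measurable_restrict)
    fix j assume "j \<in> J"
    then have "(\<lambda>y. y (j, i)) \<in> borel_measurable ?Q" for i
      by (intro measurable_component_singleton) auto
    then show "(\<lambda>y. \<chi> i. y (j, i)) \<in> borel_measurable ?Q"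
      by (subst borel_measurable_vec_iff) simp
  qed
  have fbox: "emeasure (distr \<rho> ?Q f) (Pi\<^sub>E ?K B)
      = emeasure \<rho> (\<Pi>\<^sub>E j\<in>J. {x. \<forall>i. x $ i \<in> B (j, i)})"
    if s: "sets \<rho> = sets ?P" and "\<And>k. k \<in> ?K \<Longrightarrow> B k \<in> sets borel" for \<rho> B
  proof -
    have "f -` Pi\<^sub>E ?K B \<inter> space \<rho> = (\<Pi>\<^sub>E j\<in>J. {x. \<forall>i. x $ i \<in> B (j, i)})"
      using sets_eq_imp_space_eq[OF s] by (auto simp: f_def space_PiM PiE_iff)
    then show ?thesis
      using that f \<open>finite J\<close>
      by (subst emeasure_distr) (auto simp: measurable_cong_sets[OF s refl] intro!: sets_PiM_I_finite)
  qed
  have inv: "distr (distr \<rho> ?Q f) ?P h = \<rho>" if s: "sets \<rho> = sets ?P" for \<rho>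
  proof -
    have "distr (distr \<rho> ?Q f) ?P h = distr \<rho> ?P (h \<circ> f)"
      using f h by (subst distr_distr) (auto simp: measurable_cong_sets[OF s refl])
    also have "\<dots> = distr \<rho> ?P (\<lambda>x. x)"
    proof (rule distr_cong[OF refl refl])
      fix x assume "x \<in> space \<rho>"
      then have "x \<in> extensional J"
        using sets_eq_imp_space_eq[OF s] by (auto simp: space_PiM PiE_iff)
      then show "(h \<circ> f) x = x"
        by (auto simp: h_def f_def fun_eq_iff vec_eq_iff extensional_def)
    qed
    also have "\<dots> = \<rho>" using s by (intro distr_id2) auto
    finally show ?thesis .
  qed
  have "distr \<mu> ?Q f = distr \<nu> ?Q f"
  proof (rule measure_eqI_PiM_finite[where A = "\<lambda>_. Pi\<^sub>E ?K (\<lambda>_. UNIV)"])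
    show "range (\<lambda>_. Pi\<^sub>E ?K (\<lambda>_. UNIV)) \<subseteq> prod_algebra ?K (\<lambda>_. borel :: real measure)"
      using \<open>finite J\<close> by (auto intro!: prod_algebraI_finite)
    show "emeasure (distr \<mu> ?Q f) (Pi\<^sub>E ?K (\<lambda>_. UNIV)) \<noteq> \<infinity>" for i :: nat
      by (subst fbox) (auto simp: sets)
    fix B :: "nat \<times> 'n \<Rightarrow> real set"
    assume B: "\<And>k. k \<in> ?K \<Longrightarrow> B k \<in> sets borel"
    define B' where "B' j i = (if j \<in> J then B (j, i) else UNIV)" for j i
    have "(\<Pi>\<^sub>E j\<in>J. {x. \<forall>i. x $ i \<in> B (j, i)}) = (\<Pi>\<^sub>E j\<in>J. {x :: real ^ 'n. \<forall>i. x $ i \<in> B' j i})"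
      by (rule PiE_cong) (auto simp: B'_def)
    then show "emeasure (distr \<mu> ?Q f) (Pi\<^sub>E ?K B) = emeasure (distr \<nu> ?Q f) (Pi\<^sub>E ?K B)"
      using eq[of B'] B by (simp add: fbox sets B'_def)
  qed (use \<open>finite J\<close> in \<open>auto simp: space_PiM\<close>)
  then show ?thesis
    using inv sets by metis
qed

section \<open>One coordinate: cells and pairs of distinct cells\<close>

text \<open>The conditional probability of \<open>B\<close> for a point that is uniform in the \<open>k\<close>-th of \<open>N\<close> cells of \<open>[0,1)\<close>.\<close>
definition cell_mass :: "nat \<Rightarrow> nat \<Rightarrow> real set \<Rightarrow> real" where
  "cell_mass N k B = real N * measure lborel (B \<inter> {real k / real N ..< real (k + 1) / real N})"

definition distinct_pair_mean :: "nat \<Rightarrow> (nat \<Rightarrow> nat \<Rightarrow> real) \<Rightarrow> real" where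
  "distinct_pair_mean N f = (\<Sum>x<N. \<Sum>y\<in>{..<N} - {x}. f x y) / (real N * (real N - 1))"

lemma cell_mass_UNIV: "0 < N \<Longrightarrow> cell_mass N k UNIV = 1"
  by (simp add: cell_mass_def divide_right_mono diff_divide_distrib[symmetric])

lemma sum_cell_mass:
  assumes "0 < N" and B: "B \<in> sets borel"
  shows "(\<Sum>k<N. cell_mass N k B) = real N * measure lborel (B \<inter> {0..<1})"
proof -
  have fin: "emeasure lborel (B \<inter> {a..<b}) \<noteq> \<infinity>" for a b :: real
  proof -
    have "emeasure lborel (B \<inter> {a..<b}) \<le> emeasure lborel {a..b}"
      using B by (intro emeasure_mono) auto
    also have "\<dots> < \<infinity>" by (simp add: emeasure_lborel_Icc_eq)
    finally show ?thesis by simp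
  qed
  have "(\<Sum>k<n. measure lborel (B \<inter> {real k / real N ..< real (k + 1) / real N}))
      = measure lborel (B \<inter> {0..<real n / real N})" for n
  proof (induction n)
    case (Suc n)
    let ?U = "B \<inter> {0..<real n / real N}"
    let ?V = "B \<inter> {real n / real N ..< real (n + 1) / real N}"
    have ge: "(0::real) \<le> real n / real N" and le: "real n / real N \<le> real (n + 1) / real N"
      by (auto simp: divide_right_mono)
    have "B \<inter> {0..<real (Suc n) / real N} = ?U \<union> ?V"
      using order_trans[OF ge] order_less_le_trans[OF _ le] by auto
    moreover have "measure lborel (?U \<union> ?V) = measure lborel ?U + measure lborel ?V"
      using fin[of 0 "real n / real N"] fin[of "real n / real N" "real (n + 1) / real N"] B
      by (intro measure_Union) auto
    ultimately show ?case
      using Suc by simp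
  qed simp
  from this[of N] show ?thesis
    using \<open>0 < N\<close> by (simp add: cell_mass_def sum_distrib_left[symmetric])
qed

text \<open>A cell further to the right has at least as large a part in \<open>[q,1)\<close>.\<close>
lemma cell_mass_tail_mono:
  assumes "k \<le> l" "l < N" "q < 1"
  shows "cell_mass N k {q..<1} \<le> cell_mass N l {q..<1}"
proof -
  have N: "0 < real N" using assms by simp
  have cell: "measure lborel ({q..<1} \<inter> {real k / real N ..< real (k + 1) / real N})
      = max 0 (min (real (k + 1) / real N - q) (1 / real N))" if "k < N" for k
  proof -
    have le: "real (k + 1) / real N \<le> 1" using that N by (simp add: divide_le_eq)
    have len: "real (k + 1) / real N - real k / real N = 1 / real N"
      using N by (simp add: field_simps)
    have length: "measure lborel {max q a..<b} = max 0 (min (b - q) (b - a))" if "a \<le> b" for a b :: real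
      using that by (cases "max q a \<le> b") (auto simp: max_def min_def)
    have "{q..<1} \<inter> {real k / real N ..< real (k + 1) / real N}
        = {max q (real k / real N) ..< real (k + 1) / real N}"
      using le by auto
    then show ?thesis
      by (simp only: len length[of "real k / real N" "real (k + 1) / real N"] divide_right_mono)
  qed
  have "real (k + 1) / real N \<le> real (l + 1) / real N"
    using assms N by (intro divide_right_mono) auto
  then have "max 0 (min (real (k + 1) / real N - q) (1 / real N))
      \<le> max 0 (min (real (l + 1) / real N - q) (1 / real N))"
    by (simp add: min_def max_def)
  then show ?thesis
    using assms N unfolding cell_mass_def by (subst (1 2) cell) (auto intro!: mult_left_mono)
qed

lemma distinct_pair_mean_mult:
  "distinct_pair_mean N (\<lambda>x y. f x * g y)
    = ((\<Sum>x<N. f x) * (\<Sum>y<N. g y) - (\<Sum>x<N. f x * g x)) / (real N * (real N - 1))"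
proof -
  have "(\<Sum>y\<in>{..<N} - {x}. f x * g y) = f x * (\<Sum>y<N. g y) - f x * g x" if "x < N" for x
    using that by (simp add: sum_diff1 sum_distrib_left)
  then show ?thesis
    by (simp add: distinct_pair_mean_def sum_subtractf sum_distrib_right)
qed

lemma distinct_pair_mean_fst:
  assumes "2 \<le> N"
  shows "distinct_pair_mean N (\<lambda>x y. f x) = (\<Sum>x<N. f x) / real N"
proof -
  have "distinct_pair_mean N (\<lambda>x y. f x)
      = (\<Sum>x<N. f x) * (real N - 1) / (real N * (real N - 1))"
    using distinct_pair_mean_mult[of N f "\<lambda>_. 1"] by (simp add: algebra_simps)
  then show ?thesis
    using assms by simp
qed

text \<open>Chebyshev's sum inequality for the two increasing sequences bounds the diagonal sum, which is what
  the mean over distinct pairs leaves out, from below.\<close>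
lemma distinct_pair_mean_tail_le:
  assumes "2 \<le> N" and q: "q \<in> {0..<1}" and r: "r \<in> {0..<1}"
  shows "distinct_pair_mean N (\<lambda>x y. cell_mass N x {q..<1} * cell_mass N y {r..<1})
      \<le> (1 - q) * (1 - r)"
proof -
  let ?a = "\<lambda>k. cell_mass N k {q..<1}" and ?b = "\<lambda>k. cell_mass N k {r..<1}"
  have tail: "(\<Sum>k<N. cell_mass N k {q..<1}) = real N * (1 - q)" if "q \<in> {0..<1}" for q
  proof -
    have "{q..<1} \<inter> {0..<1} = {q..<1}" using that by auto
    then show ?thesis using that sum_cell_mass[of N "{q..<1}"] assms(1) by simp
  qed
  \<comment> \<open>Chebyshev's inequality is applied to oppositely sorted sequences, hence the sign.\<close>
  have "of_nat N * (\<Sum>k=0..<N. ?a k * - ?b k) \<le> (\<Sum>k=0..<N. ?a k) * (\<Sum>k=0..<N. - ?b k)"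
    using q r by (intro Chebyshev_sum_upper) (auto intro: cell_mass_tail_mono)
  then have "(\<Sum>k<N. ?a k) * (\<Sum>k<N. ?b k) \<le> real N * (\<Sum>k<N. ?a k * ?b k)"
    by (simp add: sum_negf lessThan_atLeast0)
  then have "real N * (1 - q) * (real N * (1 - r)) \<le> real N * (\<Sum>k<N. ?a k * ?b k)"
    by (simp only: tail q r)
  then have "real N * (1 - q) * (1 - r) \<le> (\<Sum>k<N. ?a k * ?b k)"
    using assms(1) by (simp add: mult.assoc mult.left_commute)
  then have "real N * (1 - q) * (real N * (1 - r)) - (\<Sum>k<N. ?a k * ?b k)
      \<le> (1 - q) * (1 - r) * (real N * (real N - 1))"
    by (simp add: algebra_simps)
  then show ?thesis
    using assms(1) unfolding distinct_pair_mean_mult tail[OF q] tail[OF r]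
    by (subst pos_divide_le_eq) auto
qed

section \<open>Randomly assigned cells with independent uniform points\<close>

text \<open>The common abstraction of both samplings. The assumption \<open>law\<close> says that, given a uniformly
  chosen configuration \<open>a \<in> A\<close>, the points are independent and \<open>p j\<close> is uniform in the cell with index
  vector \<open>c a j\<close>. Stating it for products of Borel sets only keeps it close to what independence of the
  underlying variables provides, and it still determines the joint law. The assumption
  \<open>distinct_pairs\<close> speaks of functions that are products over the coordinates, because sums of such
  functions over configurations factor and can be computed one coordinate at a time.\<close>
locale cell_design = prob_space M
  for M :: "'a measure" +
  fixes N :: nat and p :: "nat \<Rightarrow> 'a \<Rightarrow> real ^ 'd::finite"
    and A :: "'b set" and c :: "'b \<Rightarrow> nat \<Rightarrow> 'd \<Rightarrow> nat"
  assumes two_le: "2 \<le> N"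
    and finite_A: "finite A" and A_nonempty: "A \<noteq> {}"
    and point_measurable: "\<And>j. j \<in> {1..N} \<Longrightarrow> p j \<in> borel_measurable M"
    and law: "\<And>B. (\<And>j i. B j i \<in> sets borel) \<Longrightarrow>
      \<P>(\<omega> in M. \<forall>j\<in>{1..N}. \<forall>i. p j \<omega> $ i \<in> B j i)
        = (\<Sum>a\<in>A. \<Prod>j\<in>{1..N}. \<Prod>i\<in>UNIV. cell_mass N (c a j i) (B j i)) / real (card A)"
    and symmetric: "\<And>\<sigma>. \<sigma> permutes {1..N} \<Longrightarrow>
      \<exists>\<phi>. bij_betw \<phi> A A \<and> (\<forall>a\<in>A. \<forall>j\<in>{1..N}. c (\<phi> a) j = c a (\<sigma> j))"
    and distinct_pairs: "\<And>f :: 'd \<Rightarrow> nat \<Rightarrow> nat \<Rightarrow> real.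
      (\<Sum>a\<in>A. \<Prod>i\<in>UNIV. f i (c a 1 i) (c a 2 i))
        = real (card A) * (\<Prod>i\<in>UNIV. distinct_pair_mean N (f i))"
begin

lemma N_pos: "0 < N"
  using two_le by simp

lemma prob_permuted:
  assumes \<sigma>: "\<sigma> permutes {1..N}" and B: "\<And>j i. B j i \<in> sets borel"
  shows "\<P>(\<omega> in M. \<forall>j\<in>{1..N}. \<forall>i. p (\<sigma> j) \<omega> $ i \<in> B j i)
      = \<P>(\<omega> in M. \<forall>j\<in>{1..N}. \<forall>i. p j \<omega> $ i \<in> B j i)"
proof -
  obtain \<phi> where \<phi>: "bij_betw \<phi> A A" "\<And>a j. a \<in> A \<Longrightarrow> j \<in> {1..N} \<Longrightarrow> c (\<phi> a) j = c a (\<sigma> j)"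
    using symmetric[OF \<sigma>] by blast
  have "(\<forall>j\<in>{1..N}. \<forall>i. p (\<sigma> j) \<omega> $ i \<in> B j i)
      \<longleftrightarrow> (\<forall>j\<in>{1..N}. \<forall>i. p j \<omega> $ i \<in> B (inv \<sigma> j) i)" for \<omega>
    using permutes_in_image[OF \<sigma>] permutes_in_image[OF permutes_inv[OF \<sigma>]]
      permutes_inverses[OF \<sigma>] by metis
  then have "\<P>(\<omega> in M. \<forall>j\<in>{1..N}. \<forall>i. p (\<sigma> j) \<omega> $ i \<in> B j i)
      = (\<Sum>a\<in>A. \<Prod>j\<in>{1..N}. \<Prod>i\<in>UNIV. cell_mass N (c a j i) (B (inv \<sigma> j) i)) / real (card A)"
    using law[of "\<lambda>j. B (inv \<sigma> j)"] B by simp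
  also have "(\<Sum>a\<in>A. \<Prod>j\<in>{1..N}. \<Prod>i\<in>UNIV. cell_mass N (c a j i) (B (inv \<sigma> j) i))
      = (\<Sum>a\<in>A. \<Prod>j\<in>{1..N}. \<Prod>i\<in>UNIV. cell_mass N (c (\<phi> a) j i) (B j i))"
  proof (rule sum.cong[OF refl])
    fix a assume a: "a \<in> A"
    have "(\<Prod>j\<in>{1..N}. \<Prod>i\<in>UNIV. cell_mass N (c a j i) (B (inv \<sigma> j) i))
        = (\<Prod>j\<in>{1..N}. \<Prod>i\<in>UNIV. cell_mass N (c a (\<sigma> j) i) (B j i))"
      by (subst prod.reindex_bij_betw[OF permutes_imp_bij[OF \<sigma>], symmetric])
         (simp add: permutes_inverses[OF \<sigma>])
    then show "(\<Prod>j\<in>{1..N}. \<Prod>i\<in>UNIV. cell_mass N (c a j i) (B (inv \<sigma> j) i))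
        = (\<Prod>j\<in>{1..N}. \<Prod>i\<in>UNIV. cell_mass N (c (\<phi> a) j i) (B j i))"
      using \<phi>(2)[OF a] by simp
  qed
  also have "\<dots> = (\<Sum>a\<in>A. \<Prod>j\<in>{1..N}. \<Prod>i\<in>UNIV. cell_mass N (c a j i) (B j i))"
    by (rule sum.reindex_bij_betw[OF \<phi>(1)])
  finally show ?thesis
    using law[of B] B by simp
qed

lemma exchangeable: "exchangeable M N p"
  unfolding exchangeable_def
proof (intro allI impI)
  fix \<sigma> assume \<sigma>: "\<sigma> permutes {1..N}"
  let ?P = "Pi\<^sub>M {1..N} (\<lambda>_. borel :: (real ^ 'd) measure)"
  have meas: "(\<lambda>\<omega>. \<lambda>j\<in>{1..N}. p (\<tau> j) \<omega>) \<in> measurable M ?P" if "\<tau> permutes {1..N}" for \<tau>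
    using permutes_in_image[OF that] by (intro measurable_restrict point_measurable) auto
  have box: "emeasure (distr M ?P (\<lambda>\<omega>. \<lambda>j\<in>{1..N}. p (\<tau> j) \<omega>))
        (\<Pi>\<^sub>E j\<in>{1..N}. {x. \<forall>i. x $ i \<in> B j i})
      = \<P>(\<omega> in M. \<forall>j\<in>{1..N}. \<forall>i. p (\<tau> j) \<omega> $ i \<in> B j i)"
    if "\<tau> permutes {1..N}" "\<And>j i. B j i \<in> sets borel" for \<tau> and B :: "nat \<Rightarrow> 'd \<Rightarrow> real set"
  proof -
    have "(\<lambda>\<omega>. \<lambda>j\<in>{1..N}. p (\<tau> j) \<omega>) -` (\<Pi>\<^sub>E j\<in>{1..N}. {x. \<forall>i. x $ i \<in> B j i}) \<inter> space M
        = {\<omega>\<in>space M. \<forall>j\<in>{1..N}. \<forall>i. p (\<tau> j) \<omega> $ i \<in> B j i}"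
      by (auto simp: PiE_iff)
    then show ?thesis
      using that
      by (subst emeasure_distr[OF meas])
         (auto simp: emeasure_eq_measure intro!: sets_PiM_I_finite sets_product_box)
  qed
  show "distr M ?P (\<lambda>\<omega>. \<lambda>j\<in>{1..N}. p (\<sigma> j) \<omega>) = distr M ?P (\<lambda>\<omega>. \<lambda>j\<in>{1..N}. p j \<omega>)"
  proof (rule measure_eqI_PiM_vec)
    show "finite_measure (distr M ?P (\<lambda>\<omega>. \<lambda>j\<in>{1..N}. p (\<sigma> j) \<omega>))"
      using prob_space_distr[OF meas[OF \<sigma>]] by (simp add: prob_space_def)
    fix B :: "nat \<Rightarrow> 'd \<Rightarrow> real set"
    assume B: "\<And>j i. B j i \<in> sets borel"
    show "emeasure (distr M ?P (\<lambda>\<omega>. \<lambda>j\<in>{1..N}. p (\<sigma> j) \<omega>)) (\<Pi>\<^sub>E j\<in>{1..N}. {x. \<forall>i. x $ i \<in> B j i})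
        = emeasure (distr M ?P (\<lambda>\<omega>. \<lambda>j\<in>{1..N}. p j \<omega>)) (\<Pi>\<^sub>E j\<in>{1..N}. {x. \<forall>i. x $ i \<in> B j i})"
      using box[OF \<sigma> B] box[OF permutes_id B] prob_permuted[OF \<sigma> B] by simp
  qed auto
qed

text \<open>The joint law of the first two points factors over the coordinates; marginals and independence
  of the coordinate pairs are read off from it by taking some of the sets to be \<open>UNIV\<close>.\<close>
lemma prob_pair:
  assumes B: "\<And>i. B i \<in> sets borel" and C: "\<And>i. C i \<in> sets borel"
  shows "\<P>(\<omega> in M. (\<forall>i. p 1 \<omega> $ i \<in> B i) \<and> (\<forall>i. p 2 \<omega> $ i \<in> C i))
      = (\<Prod>i\<in>UNIV. distinct_pair_mean N (\<lambda>x y. cell_mass N x (B i) * cell_mass N y (C i)))"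
proof -
  define D where "D j = (if j = 1 then B else if j = 2 then C else (\<lambda>_. UNIV))" for j :: nat
  have D: "D j i \<in> sets borel" for j i
    using B C by (simp add: D_def)
  have idx: "{1..N} = insert 1 (insert 2 {3..N})"
    using two_le by auto
  have two_factors: "(\<Prod>j\<in>{1..N}. \<Prod>i\<in>UNIV. cell_mass N (c a j i) (D j i))
      = (\<Prod>i\<in>UNIV. cell_mass N (c a 1 i) (B i) * cell_mass N (c a 2 i) (C i))" for a
  proof -
    have "(\<Prod>j\<in>{3..N}. \<Prod>i\<in>UNIV. cell_mass N (c a j i) (D j i)) = 1"
      by (auto simp: D_def cell_mass_UNIV N_pos intro!: prod.neutral)
    then show ?thesis
      unfolding idx by (simp add: D_def prod.distrib)
  qed
  have "(\<forall>j\<in>{1..N}. \<forall>i. p j \<omega> $ i \<in> D j i)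
      \<longleftrightarrow> (\<forall>i. p 1 \<omega> $ i \<in> B i) \<and> (\<forall>i. p 2 \<omega> $ i \<in> C i)" for \<omega>
    unfolding idx by (auto simp: D_def)
  then have "\<P>(\<omega> in M. (\<forall>i. p 1 \<omega> $ i \<in> B i) \<and> (\<forall>i. p 2 \<omega> $ i \<in> C i))
      = (\<Sum>a\<in>A. \<Prod>j\<in>{1..N}. \<Prod>i\<in>UNIV. cell_mass N (c a j i) (D j i)) / real (card A)"
    using law[of D] D by simp
  also have "\<dots> = (\<Sum>a\<in>A. \<Prod>i\<in>UNIV. cell_mass N (c a 1 i) (B i) * cell_mass N (c a 2 i) (C i))
      / real (card A)"
    by (simp only: two_factors)
  also have "(\<Sum>a\<in>A. \<Prod>i\<in>UNIV. cell_mass N (c a 1 i) (B i) * cell_mass N (c a 2 i) (C i))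
      = real (card A)
        * (\<Prod>i\<in>UNIV. distinct_pair_mean N (\<lambda>x y. cell_mass N x (B i) * cell_mass N y (C i)))"
    by (rule distinct_pairs)
  finally show ?thesis
    using finite_A A_nonempty by simp
qed

lemma pair_mean_UNIV:
  assumes "B \<in> sets borel"
  shows "distinct_pair_mean N (\<lambda>x y. cell_mass N x B * cell_mass N y UNIV)
      = measure lborel (B \<inter> {0..<1})"
  using assms two_le N_pos
  by (simp add: cell_mass_UNIV distinct_pair_mean_fst sum_cell_mass)

text \<open>By symmetry every point has the law of the first one, which is a marginal of \<open>prob_pair\<close>.\<close>
lemma prob_point:
  assumes j: "j \<in> {1..N}" and B: "\<And>i. B i \<in> sets borel"
  shows "\<P>(\<omega> in M. \<forall>i. p j \<omega> $ i \<in> B i) = (\<Prod>i\<in>UNIV. measure lborel (B i \<inter> {0..<1}))"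
proof -
  define D where "D k = (if k = 1 then B else (\<lambda>_. UNIV))" for k :: nat
  have D: "D k i \<in> sets borel" for k i
    using B by (simp add: D_def)
  have one: "1 \<in> {1..N}" using N_pos by simp
  have \<sigma>: "Transposition.transpose 1 j permutes {1..N}"
    by (rule permutes_swap_id[OF one j])
  have "(\<forall>k\<in>{1..N}. \<forall>i. p (Transposition.transpose 1 j k) \<omega> $ i \<in> D k i) \<longleftrightarrow> (\<forall>i. p j \<omega> $ i \<in> B i)" for \<omega>
    using one by (auto simp: D_def)
  moreover have "(\<forall>k\<in>{1..N}. \<forall>i. p k \<omega> $ i \<in> D k i) \<longleftrightarrow> (\<forall>i. p 1 \<omega> $ i \<in> B i)" for \<omega>
    using one by (auto simp: D_def)
  ultimately have "\<P>(\<omega> in M. \<forall>i. p j \<omega> $ i \<in> B i) = \<P>(\<omega> in M. \<forall>i. p 1 \<omega> $ i \<in> B i)"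
    using prob_permuted[OF \<sigma>, of D] D by simp
  then show ?thesis
    using prob_pair[of B "\<lambda>_. UNIV"] B by (simp add: pair_mean_UNIV)
qed

lemma prob_point_coordinate:
  assumes j: "j \<in> {1..N}" and B: "B \<in> sets borel"
  shows "\<P>(\<omega> in M. p j \<omega> $ i \<in> B) = measure lborel (B \<inter> {0..<1})"
proof -
  have "(\<forall>k. p j \<omega> $ k \<in> (if k = i then B else UNIV)) \<longleftrightarrow> p j \<omega> $ i \<in> B" for \<omega>
    by auto
  moreover have "(\<Prod>k\<in>UNIV. measure lborel ((if k = i then B else UNIV) \<inter> {0..<1}))
      = measure lborel (B \<inter> {0..<1})"
    by (subst prod.remove[of _ i]) (auto intro!: prod.neutral)
  ultimately show ?thesis
    using prob_point[OF j, of "\<lambda>k. if k = i then B else UNIV"] B by simp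
qed

lemma prob_pair_coordinate:
  assumes B: "B \<in> sets borel" and C: "C \<in> sets borel"
  shows "\<P>(\<omega> in M. p 1 \<omega> $ i \<in> B \<and> p 2 \<omega> $ i \<in> C)
      = distinct_pair_mean N (\<lambda>x y. cell_mass N x B * cell_mass N y C)"
proof -
  let ?B = "\<lambda>k. if k = i then B else UNIV" and ?C = "\<lambda>k. if k = i then C else UNIV"
  have "(\<forall>k. p 1 \<omega> $ k \<in> ?B k) \<and> (\<forall>k. p 2 \<omega> $ k \<in> ?C k) \<longleftrightarrow> p 1 \<omega> $ i \<in> B \<and> p 2 \<omega> $ i \<in> C" for \<omega>
    by auto
  moreover have "(\<Prod>k\<in>UNIV. distinct_pair_mean N (\<lambda>x y. cell_mass N x (?B k) * cell_mass N y (?C k)))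
      = distinct_pair_mean N (\<lambda>x y. cell_mass N x B * cell_mass N y C)"
    using pair_mean_UNIV[of UNIV] by (subst prod.remove[of _ i]) (auto intro!: prod.neutral)
  ultimately show ?thesis
    using prob_pair[of ?B ?C] B C by simp
qed

lemma sampling_scheme: "sampling_scheme M N p"
  unfolding sampling_scheme_def uniform_on_def
proof (intro conjI ballI exchangeable)
  fix j assume j: "j \<in> {1..N}"
  show "p j \<in> borel_measurable M" by (rule point_measurable[OF j])
  show "distr M borel (p j) = uniform_measure lborel (cube 1)"
  proof (rule measure_eqI_vec)
    show "finite_measure (distr M borel (p j))"
      using prob_space_distr[OF point_measurable[OF j]] by (simp add: prob_space_def)
    fix B :: "'d \<Rightarrow> real set"
    assume B: "\<And>i. B i \<in> sets borel"
    have "emeasure (distr M borel (p j)) {x. \<forall>i. x $ i \<in> B i} = \<P>(\<omega> in M. \<forall>i. p j \<omega> $ i \<in> B i)"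
      using point_measurable[OF j] B
      by (subst emeasure_distr) (auto simp: sets_product_box emeasure_eq_measure intro!: arg_cong[where f = prob])
    then show "emeasure (distr M borel (p j)) {x. \<forall>i. x $ i \<in> B i}
        = emeasure (uniform_measure lborel (cube 1)) {x. \<forall>i. x $ i \<in> B i}"
      using emeasure_uniform_cube[of 1 B] prob_point[OF j B] B by simp
  qed auto
qed

lemma coordinate_NQD:
  assumes q: "q \<in> {0..<1}" and r: "r \<in> {0..<1}"
  shows "\<P>(\<omega> in M. p 1 \<omega> $ i \<in> {q..<1} \<and> p 2 \<omega> $ i \<in> {r..<1})
      \<le> \<P>(\<omega> in M. p 1 \<omega> $ i \<in> {q..<1}) * \<P>(\<omega> in M. p 2 \<omega> $ i \<in> {r..<1})"
proof -
  have tail: "\<P>(\<omega> in M. p j \<omega> $ i \<in> {s..<1}) = 1 - s" if "j \<in> {1..N}" "s \<in> {0..<1}" for j s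
  proof -
    have "{s..<1} \<inter> {0..<1} = {s..<1}" using that by auto
    then show ?thesis
      using prob_point_coordinate[OF that(1), of "{s..<1}"] that by simp
  qed
  have "1 \<in> {1..N}" "2 \<in> {1..N}" using two_le by auto
  then show ?thesis
    using distinct_pair_mean_tail_le[OF two_le q r] prob_pair_coordinate[of "{q..<1}" "{r..<1}"]
    by (simp only: tail q r) simp
qed

lemma negative_dependence:
  assumes Q: "Q \<in> boxes_at_one" and R: "R \<in> boxes_at_one"
  shows "\<P>(\<omega> in M. p 1 \<omega> \<in> Q \<and> p 2 \<omega> \<in> R)
      \<le> \<P>(\<omega> in M. p 1 \<omega> \<in> Q) * \<P>(\<omega> in M. p 2 \<omega> \<in> R)"
proof -
  obtain q r :: "real ^ 'd" where
    Q: "Q = {y. \<forall>i. y $ i \<in> {q $ i..<1}}" and q: "\<And>i. q $ i \<in> {0..<1}" and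
    R: "R = {y. \<forall>i. y $ i \<in> {r $ i..<1}}" and r: "\<And>i. r $ i \<in> {0..<1}"
    using Q R by (auto simp: boxes_at_one_def cube_def)
  have idx: "1 \<in> {1..N}" "2 \<in> {1..N}" using two_le by auto
  have point: "\<P>(\<omega> in M. \<forall>i. p j \<omega> $ i \<in> {s $ i..<1})
      = (\<Prod>i\<in>UNIV. \<P>(\<omega> in M. p j \<omega> $ i \<in> {s $ i..<1}))" if "j \<in> {1..N}" for j and s :: "real ^ 'd"
  proof -
    have "\<P>(\<omega> in M. p j \<omega> $ i \<in> {s $ i..<1}) = measure lborel ({s $ i..<1} \<inter> {0..<1})" for i
      by (rule prob_point_coordinate[OF that]) simp
    then show ?thesis
      using prob_point[OF that, of "\<lambda>i. {s $ i..<1}"] by simp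
  qed
  have "\<P>(\<omega> in M. p 1 \<omega> \<in> Q \<and> p 2 \<omega> \<in> R)
      = (\<Prod>i\<in>UNIV. distinct_pair_mean N
          (\<lambda>x y. cell_mass N x {q $ i..<1} * cell_mass N y {r $ i..<1}))"
    unfolding Q R using prob_pair[of "\<lambda>i. {q $ i..<1}" "\<lambda>i. {r $ i..<1}"] by simp
  also have "\<dots> = (\<Prod>i\<in>UNIV. \<P>(\<omega> in M. p 1 \<omega> $ i \<in> {q $ i..<1} \<and> p 2 \<omega> $ i \<in> {r $ i..<1}))"
    by (intro prod.cong refl prob_pair_coordinate[symmetric]) auto
  also have "\<dots> \<le> (\<Prod>i\<in>UNIV. \<P>(\<omega> in M. p 1 \<omega> $ i \<in> {q $ i..<1})
      * \<P>(\<omega> in M. p 2 \<omega> $ i \<in> {r $ i..<1}))"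
    by (intro prod_mono conjI coordinate_NQD q r) simp
  also have "\<dots> = \<P>(\<omega> in M. p 1 \<omega> \<in> Q) * \<P>(\<omega> in M. p 2 \<omega> \<in> R)"
    unfolding Q R mem_Collect_eq by (simp only: point idx prod.distrib)
  finally show ?thesis .
qed

lemma coordinate_pairs_independent:
  "indep_vars (\<lambda>_. borel \<Otimes>\<^sub>M borel) (\<lambda>i \<omega>. (p 1 \<omega> $ i, p 2 \<omega> $ i)) UNIV"
proof (subst indep_vars_finite[where E = "\<lambda>_. {B \<times> C | B C. B \<in> sets borel \<and> C \<in> sets borel}"])
  show "sets (borel \<Otimes>\<^sub>M borel) = sigma_sets (space (borel \<Otimes>\<^sub>M borel))
      {B \<times> C | B C. B \<in> sets (borel :: real measure) \<and> C \<in> sets (borel :: real measure)}"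
    by (simp add: sets_pair_measure space_pair_measure)
  show "random_variable (borel \<Otimes>\<^sub>M borel) (\<lambda>\<omega>. (p 1 \<omega> $ i, p 2 \<omega> $ i))" for i
    using point_measurable[of 1] point_measurable[of 2] two_le
    by (intro measurable_Pair) (auto simp: borel_measurable_vec_iff)
  show "Int_stable {B \<times> C | B C. B \<in> sets (borel :: real measure) \<and> C \<in> sets (borel :: real measure)}"
    by (rule Int_stable_pair_measure_generator)
  show "space (borel \<Otimes>\<^sub>M borel) \<in>
      {B \<times> C | B C. B \<in> sets (borel :: real measure) \<and> C \<in> sets (borel :: real measure)}"
    by (auto simp: space_pair_measure intro!: exI[of _ UNIV])
  show "\<forall>D\<in>UNIV \<rightarrow> {B \<times> C | B C. B \<in> sets borel \<and> C \<in> sets borel}.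
      prob (\<Inter>i\<in>UNIV. (\<lambda>\<omega>. (p 1 \<omega> $ i, p 2 \<omega> $ i)) -` D i \<inter> space M)
      = (\<Prod>i\<in>UNIV. prob ((\<lambda>\<omega>. (p 1 \<omega> $ i, p 2 \<omega> $ i)) -` D i \<inter> space M))"
  proof
    fix D :: "'d \<Rightarrow> (real \<times> real) set"
    assume "D \<in> UNIV \<rightarrow> {B \<times> C | B C. B \<in> sets borel \<and> C \<in> sets borel}"
    then have "\<exists>B C. D i = B \<times> C \<and> B \<in> sets borel \<and> C \<in> sets borel" for i
      by (auto simp: Pi_iff)
    then obtain B C where D: "\<And>i. D i = B i \<times> C i"
      and BC: "\<And>i. B i \<in> sets borel" "\<And>i. C i \<in> sets borel"
      by metis
    have inter: "(\<Inter>i\<in>UNIV. {\<omega>\<in>space M. p 1 \<omega> $ i \<in> B i \<and> p 2 \<omega> $ i \<in> C i})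
        = {\<omega>\<in>space M. (\<forall>i. p 1 \<omega> $ i \<in> B i) \<and> (\<forall>i. p 2 \<omega> $ i \<in> C i)}"
      by auto
    have each: "(\<lambda>\<omega>. (p 1 \<omega> $ i, p 2 \<omega> $ i)) -` D i \<inter> space M
        = {\<omega>\<in>space M. p 1 \<omega> $ i \<in> B i \<and> p 2 \<omega> $ i \<in> C i}" for i
      by (auto simp: D)
    show "prob (\<Inter>i\<in>UNIV. (\<lambda>\<omega>. (p 1 \<omega> $ i, p 2 \<omega> $ i)) -` D i \<inter> space M)
        = (\<Prod>i\<in>UNIV. prob ((\<lambda>\<omega>. (p 1 \<omega> $ i, p 2 \<omega> $ i)) -` D i \<inter> space M))"
      by (simp only: each inter prob_pair[of B C, OF BC] prob_pair_coordinate[OF BC])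
  qed
qed (auto simp: space_pair_measure)

theorem pairwise_negatively_dependent: "pairwise_negatively_dependent M N p"
  using sampling_scheme negative_dependence by (simp add: pairwise_negatively_dependent_def)

theorem coordinatewise_independent_NQD: "coordinatewise_independent_NQD M N p"
  using sampling_scheme coordinate_pairs_independent coordinate_NQD
  unfolding coordinatewise_independent_NQD_def by blast

end

section \<open>Conditioning on the configuration\<close>
lemma (in prob_space) prob_uniform_cube:
  fixes X :: "'a \<Rightarrow> real ^ 'n::finite"
  assumes X: "uniform_on M X (cube a)" and a: "0 < a" and B: "\<And>i. B i \<in> sets borel"
  shows "\<P>(\<omega> in M. \<forall>i. X \<omega> $ i \<in> B i) = (\<Prod>i\<in>UNIV. measure lborel (B i \<inter> {0..<a}) / a)"
proof -
  have X: "X \<in> borel_measurable M" "distr M borel X = uniform_measure lborel (cube a)"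
    using X by (auto simp: uniform_on_def)
  have "ennreal (\<P>(\<omega> in M. \<forall>i. X \<omega> $ i \<in> B i)) = emeasure (distr M borel X) {x. \<forall>i. x $ i \<in> B i}"
    using X(1) B
    by (subst emeasure_distr) (auto simp: sets_product_box emeasure_eq_measure intro!: arg_cong[where f = prob])
  then show ?thesis
    unfolding X(2) using a B by (simp add: emeasure_uniform_cube prod_nonneg)
qed

text \<open>The law of total probability for a uniformly distributed case. The cases need to cover the space
  only up to a null set, which is automatic because their probabilities add up to one; so values of
  the discrete variables outside their nominal range never have to be discussed.\<close>
lemma (in prob_space) prob_eq_mean_over_cases:
  assumes "finite A" "A \<noteq> {}" and E: "\<And>a. a \<in> A \<Longrightarrow> E a \<in> events" and disj: "disjoint_family_on E A"
    and uniform: "\<And>a. a \<in> A \<Longrightarrow> prob (E a) = 1 / real (card A)"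
    and F: "F \<in> events" and w: "\<And>a. a \<in> A \<Longrightarrow> prob (F \<inter> E a) = prob (E a) * w a"
  shows "prob F = (\<Sum>a\<in>A. w a) / real (card A)"
proof -
  have "prob (\<Union>a\<in>A. E a) = (\<Sum>a\<in>A. prob (E a))"
    using assms(1) E disj by (intro finite_measure_finite_Union) auto
  also have "\<dots> = 1"
    using assms(1,2) by (simp add: uniform)
  finally have one: "prob (\<Union>a\<in>A. E a) = 1" .
  have "prob F = prob (F \<inter> (\<Union>a\<in>A. E a))"
  proof (rule finite_measure_eq_AE)
    have "AE \<omega> in M. \<omega> \<in> (\<Union>a\<in>A. E a)"
      using one assms(1) E by (subst (asm) prob_eq_1) auto
    then show "AE \<omega> in M. \<omega> \<in> F \<longleftrightarrow> \<omega> \<in> F \<inter> (\<Union>a\<in>A. E a)"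
      by eventually_elim auto
  qed (use assms(1) E F in auto)
  also have "F \<inter> (\<Union>a\<in>A. E a) = (\<Union>a\<in>A. F \<inter> E a)"
    by auto
  also have "prob \<dots> = (\<Sum>a\<in>A. prob (F \<inter> E a))"
    using assms(1) E F disj by (intro finite_measure_finite_Union) (auto simp: disjoint_family_on_def)
  also have "\<dots> = (\<Sum>a\<in>A. w a) / real (card A)"
    by (simp add: w uniform sum_divide_distrib)
  finally show ?thesis .
qed

lemma measure_lborel_affine_vimage:
  fixes S :: "real set"
  assumes "c \<noteq> 0" and S: "S \<in> sets borel"
  shows "measure lborel {t. b + c * t \<in> S} = measure lborel S / \<bar>c\<bar>"
proof -
  have meas: "(\<lambda>t. b + c * t) \<in> borel_measurable lborel"
    by simp
  have "emeasure lborel S = \<bar>c\<bar> * emeasure (distr lborel borel (\<lambda>t. b + c * t)) S"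
    using assms by (subst lborel_real_affine[of c b]) (auto simp: emeasure_density nn_integral_cmult)
  also have "emeasure (distr lborel borel (\<lambda>t. b + c * t)) S = emeasure lborel {t. b + c * t \<in> S}"
    using S by (subst emeasure_distr[OF meas]) (auto simp: vimage_def)
  finally have "measure lborel S = \<bar>c\<bar> * measure lborel {t. b + c * t \<in> S}"
    by (simp add: measure_def enn2real_mult)
  then show ?thesis
    using assms by simp
qed

lemma cell_mass_jitter:
  assumes "0 < N" and B: "B \<in> sets borel"
  shows "measure lborel ({t. real k / real N + t \<in> B} \<inter> {0..<1 / real N}) / (1 / real N)
    = cell_mass N k B"
proof -
  have "{t. real k / real N + t \<in> B} \<inter> {0..<1 / real N}
      = {t. real k / real N + 1 * t \<in> B \<inter> {real k / real N ..< real (k + 1) / real N}}"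
    by (auto simp: add_divide_distrib)
  then show ?thesis
    using measure_lborel_affine_vimage[of 1 "B \<inter> {real k / real N ..< real (k + 1) / real N}" "real k / real N"] B
    by (simp add: cell_mass_def mult.commute)
qed

text \<open>The Latin hypercube offset is subtracted, so the point runs through its cell with the right instead
  of the left endpoint included; this changes only a null set.\<close>
lemma cell_mass_reflected_offset:
  assumes "0 < N" and B: "B \<in> sets borel"
  shows "measure lborel ({t. (real (Suc k) - t) / real N \<in> B} \<inter> {0..<1}) = cell_mass N k B"
proof -
  let ?u = "real k / real N" and ?v = "real (k + 1) / real N"
  have "{t. (real (Suc k) - t) / real N \<in> B} \<inter> {0..<1}
      = {t. ?v + (- 1 / real N) * t \<in> B \<inter> {?u<..?v}}"
  proof -
    have "?v + (- 1 / real N) * t = (real (Suc k) - t) / real N" for t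
      by (simp add: add_divide_distrib diff_divide_distrib)
    moreover have "(real (Suc k) - t) / real N \<in> {?u<..?v} \<longleftrightarrow> t \<in> {0..<1}" for t
      using \<open>0 < N\<close> by (auto simp: divide_less_cancel divide_le_cancel)
    ultimately show ?thesis by auto
  qed
  then have "measure lborel ({t. (real (Suc k) - t) / real N \<in> B} \<inter> {0..<1})
      = real N * measure lborel (B \<inter> {?u<..?v})"
    using measure_lborel_affine_vimage[of "- 1 / real N" "B \<inter> {?u<..?v}" ?v] assms by simp
  also have "measure lborel (B \<inter> {?u<..?v}) = measure lborel (B \<inter> {?u..<?v})"
    using AE_lborel_singleton[of ?u] AE_lborel_singleton[of ?v] B
    by (intro measure_eq_AE) auto
  finally show ?thesis by (simp add: cell_mass_def)
qed

text \<open>A shifted lattice point lies on the grid, and a jitter smaller than the mesh width does not wrap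
  around. The reductions modulo one therefore leave the lower corner of a cell plus the jitter.\<close>
lemma frac_lattice_point:
  assumes "0 < N" and t: "0 \<le> t" "t < 1 / real N"
  shows "frac (frac (real m * (real k / real N)) + real s / real N + t)
    = real ((m * k + s) mod N) / real N + t"
proof -
  let ?r = "(m * k + s) mod N" and ?q = "(m * k + s) div N"
  let ?f = "\<lfloor>real m * (real k / real N)\<rfloor>"
  have "real (m * k + s) = real ?q * real N + real ?r"
    by (metis div_mult_mod_eq of_nat_add of_nat_mult)
  then have "real m * (real k / real N) + real s / real N = real ?q + real ?r / real N"
    using assms by (simp add: field_simps)
  then have eq: "frac (real m * (real k / real N)) + real s / real N + t
      = (real ?r / real N + t) + of_int (int ?q - ?f)"
    by (simp add: frac_def)
  have "real ?r + 1 \<le> real N"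
    using mod_less_divisor[OF \<open>0 < N\<close>, of "m * k + s"] by linarith
  then have "real ?r / real N + 1 / real N \<le> 1"
    using assms by (simp add: field_simps)
  then have range: "0 \<le> real ?r / real N + t" "real ?r / real N + t < 1"
    using t by (auto intro: add_nonneg_nonneg)
  show ?thesis
    unfolding eq frac_unique_iff using range by simp
qed

section \<open>Uniform pairs of distinct cells\<close>
definition off_diagonal :: "nat \<Rightarrow> (nat \<times> nat) set" where
  "off_diagonal N = {(x, y). x < N \<and> y < N \<and> x \<noteq> y}"

lemma off_diagonal_Sigma: "off_diagonal N = Sigma {..<N} (\<lambda>x. {..<N} - {x})"
  by (auto simp: off_diagonal_def)

lemma finite_off_diagonal: "finite (off_diagonal N)"
  by (simp add: off_diagonal_Sigma)

lemma card_off_diagonal: "card (off_diagonal N) = N * (N - 1)"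
  by (simp add: off_diagonal_Sigma)

lemma sum_off_diagonal:
  assumes "2 \<le> N"
  shows "(\<Sum>(x, y)\<in>off_diagonal N. f x y) = real (N * (N - 1)) * distinct_pair_mean N f"
  using assms by (simp add: off_diagonal_Sigma distinct_pair_mean_def sum.Sigma of_nat_diff)

text \<open>The difference of the two images is \<open>(m - n) * k\<close>, which is nonzero modulo the prime \<open>N\<close> when
  \<open>k\<close> is. The map is injective because this difference determines \<open>k\<close> and then either image determines
  \<open>s\<close>; both sides have \<open>N * (N - 1)\<close> elements.\<close>
lemma lattice_pair_bij:
  assumes N: "prime N" and m: "m < N" "n < N" "m \<noteq> n"
  shows "bij_betw (\<lambda>(k, s). ((m * k + s) mod N, (n * k + s) mod N))
    ({1..<N} \<times> {..<N}) (off_diagonal N)"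
proof -
  let ?F = "\<lambda>(k, s). ((m * k + s) mod N, (n * k + s) mod N)"
  let ?Z = "{1..<N} \<times> {..<N}"
  have N0: "0 < N" using N by (rule prime_gt_0_nat)
  have prime: "prime (int N)" using N by simp
  have zero: "x = y" if "int N dvd int x - int y" "x < N" "y < N" for x y
  proof -
    have "int x mod int N = int y mod int N" using that(1) by (simp add: mod_eq_dvd_iff)
    then show ?thesis using that by simp
  qed
  have diff: "\<not> int N dvd int m - int n" using zero m by blast
  have mod_dvd: "int N dvd int x - int y" if "x mod N = y mod N" for x y
    using that by (metis mod_eq_dvd_iff of_nat_mod)
  have inj: "inj_on ?F ?Z"
  proof (rule inj_onI, clarify)
    fix k s k' s' assume range: "k \<in> {1..<N}" "s < N" "k' \<in> {1..<N}" "s' < N"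
    assume "(m * k + s) mod N = (m * k' + s') mod N" "(n * k + s) mod N = (n * k' + s') mod N"
    then have d: "int N dvd int (m * k + s) - int (m * k' + s')" "int N dvd int (n * k + s) - int (n * k' + s')"
      by (auto dest: mod_dvd)
    have "int N dvd (int (m * k + s) - int (m * k' + s')) - (int (n * k + s) - int (n * k' + s'))"
      using d by (rule dvd_diff)
    also have "\<dots> = (int m - int n) * (int k - int k')"
      by (simp add: algebra_simps)
    finally have "int N dvd int k - int k'"
      using prime_dvd_multD[OF prime] diff by blast
    then have k: "k = k'" using zero range by auto
    with d(1) have "int N dvd int s - int s'" by simp
    then show "k = k' \<and> s = s'" using k zero range by auto
  qed
  have "?F ` ?Z \<subseteq> off_diagonal N"
  proof clarify
    fix k s assume range: "k \<in> {1..<N}" "s < N"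
    have "(m * k + s) mod N \<noteq> (n * k + s) mod N"
    proof
      assume "(m * k + s) mod N = (n * k + s) mod N"
      then have "int N dvd int (m * k + s) - int (n * k + s)" by (rule mod_dvd)
      also have "\<dots> = (int m - int n) * (int k - int 0)" by (simp add: algebra_simps)
      finally have "int N dvd int k - int 0"
        using prime_dvd_multD[OF prime] diff by blast
      then show False using zero[of k 0] range N0 by simp
    qed
    then show "((m * k + s) mod N, (n * k + s) mod N) \<in> off_diagonal N"
      using N0 by (simp add: off_diagonal_def)
  qed
  moreover have "card (?F ` ?Z) = card (off_diagonal N)"
    using inj by (simp add: card_image card_off_diagonal card_cartesian_product mult.commute)
  ultimately have "?F ` ?Z = off_diagonal N"
    by (intro card_subset_eq finite_off_diagonal)
  with inj show ?thesis by (simp add: bij_betw_def)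
qed

lemma permutation_with_two_values:
  assumes "j \<in> {1..N}" "k \<in> {1..N}" "j \<noteq> k" "2 \<le> (N :: nat)"
  obtains \<rho> where "\<rho> permutes {1..N}" "\<rho> 1 = j" "\<rho> 2 = k"
proof -
  let ?s = "Transposition.transpose 1 j"
  have s: "?s permutes {1..N}"
    using assms by (intro permutes_swap_id) auto
  have s2: "?s 2 \<in> {1..N}" "?s 2 \<noteq> j"
    using permutes_in_image[OF s, of 2] assms by (auto simp: Transposition.transpose_def split: if_splits)
  let ?\<rho> = "Transposition.transpose (?s 2) k \<circ> ?s"
  have "?\<rho> permutes {1..N}"
    using s s2 assms by (intro permutes_compose permutes_swap_id) auto
  moreover have "?\<rho> 1 = j" "?\<rho> 2 = k"
    using s2 assms by (auto simp: Transposition.transpose_def)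
  ultimately show thesis by (rule that)
qed

lemma permutes_compose_bij:
  assumes "\<sigma> permutes S"
  shows "bij_betw (\<lambda>\<tau>. \<tau> \<circ> \<sigma>) {\<tau>. \<tau> permutes S} {\<tau>. \<tau> permutes S}"
proof (rule bij_betwI[where g = "\<lambda>\<tau>. \<tau> \<circ> inv \<sigma>"])
  show "(\<lambda>\<tau>. \<tau> \<circ> \<sigma>) \<in> {\<tau>. \<tau> permutes S} \<rightarrow> {\<tau>. \<tau> permutes S}"
    using assms by (auto intro: permutes_compose)
  show "(\<lambda>\<tau>. \<tau> \<circ> inv \<sigma>) \<in> {\<tau>. \<tau> permutes S} \<rightarrow> {\<tau>. \<tau> permutes S}"
    using permutes_inv[OF assms] by (auto intro: permutes_compose)
qed (auto simp: comp_assoc permutes_inv_o[OF assms])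

text \<open>Double counting: by composing with a permutation that moves \<open>1\<close> and \<open>2\<close> elsewhere, the sum does
  not change when \<open>1\<close> and \<open>2\<close> are replaced by any two distinct arguments. Summed over all such pairs
  of arguments, a single permutation contributes each pair of distinct values exactly once.\<close>
lemma sum_permutations_pair:
  fixes f :: "nat \<Rightarrow> nat \<Rightarrow> real"
  assumes N: "2 \<le> N"
  shows "(\<Sum>\<tau> | \<tau> permutes {1..N}. f (\<tau> 1 - 1) (\<tau> 2 - 1))
    = real (card {\<tau>. \<tau> permutes {1..N}}) * distinct_pair_mean N f"
proof -
  let ?P = "{\<tau>. \<tau> permutes {1..N}}"
  let ?T = "\<Sum>\<tau>\<in>?P. f (\<tau> 1 - 1) (\<tau> 2 - 1)"
  have "(\<Sum>\<tau>\<in>?P. f (\<tau> (Suc x) - 1) (\<tau> (Suc y) - 1)) = ?T" if xy: "(x, y) \<in> off_diagonal N" for x y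
  proof -
    obtain \<rho> where \<rho>: "\<rho> permutes {1..N}" "\<rho> 1 = Suc x" "\<rho> 2 = Suc y"
      using permutation_with_two_values[of "Suc x" N "Suc y"] xy N by (auto simp: off_diagonal_def)
    show ?thesis
      using sum.reindex_bij_betw[OF permutes_compose_bij[OF \<rho>(1)],
          of "\<lambda>\<tau>. f (\<tau> 1 - 1) (\<tau> 2 - 1)"] \<rho>(2,3) by simp
  qed
  then have values_eq: "(\<Sum>\<tau>\<in>?P. f (\<tau> (Suc (fst z)) - 1) (\<tau> (Suc (snd z)) - 1)) = ?T"
    if "z \<in> off_diagonal N" for z
    using that by (cases z) simp
  have "real (N * (N - 1)) * ?T = (\<Sum>z\<in>off_diagonal N. ?T)"
    by (simp only: sum_constant card_off_diagonal)
  also have "\<dots> = (\<Sum>z\<in>off_diagonal N. \<Sum>\<tau>\<in>?P. f (\<tau> (Suc (fst z)) - 1) (\<tau> (Suc (snd z)) - 1))"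
    by (rule sum.cong[OF refl values_eq[symmetric]])
  also have "\<dots> = (\<Sum>\<tau>\<in>?P. \<Sum>z\<in>off_diagonal N. f (\<tau> (Suc (fst z)) - 1) (\<tau> (Suc (snd z)) - 1))"
    by (rule sum.swap)
  also have "\<dots> = (\<Sum>\<tau>\<in>?P. \<Sum>(x, y)\<in>off_diagonal N. f x y)"
  proof (rule sum.cong[OF refl])
    fix \<tau> assume "\<tau> \<in> ?P"
    then have \<tau>: "\<tau> permutes {1..N}" by simp
    let ?t = "\<lambda>x. \<tau> (Suc x) - 1"
    have val: "\<tau> (Suc x) \<in> {1..N}" if "x < N" for x
      using permutes_in_image[OF \<tau>, of "Suc x"] that by simp
    have inj: "x = y" if "?t x = ?t y" "x < N" "y < N" for x y
    proof -
      have "\<tau> (Suc x) = \<tau> (Suc y)" using that val[of x] val[of y] by (simp del: One_nat_def) linarith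
      then show ?thesis using permutes_inj[OF \<tau>] by (simp add: inj_eq)
    qed
    have less: "?t x < N" if "x < N" for x
      using val[OF that] by auto
    have "(?t x, ?t y) \<in> off_diagonal N" if "(x, y) \<in> off_diagonal N" for x y
      using that less[of x] less[of y] inj[of x y] by (simp add: off_diagonal_def) argo
    then have "(\<lambda>z. (?t (fst z), ?t (snd z))) ` off_diagonal N \<subseteq> off_diagonal N"
      by force
    moreover have "inj_on (\<lambda>z. (?t (fst z), ?t (snd z))) (off_diagonal N)"
    proof (rule inj_onI)
      fix z z' assume "z \<in> off_diagonal N" "z' \<in> off_diagonal N"
        and "(?t (fst z), ?t (snd z)) = (?t (fst z'), ?t (snd z'))"
      then show "z = z'"
        using inj[of "fst z" "fst z'"] inj[of "snd z" "snd z'"]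
        by (cases z; cases z') (simp add: off_diagonal_def)
    qed
    ultimately have "bij_betw (\<lambda>z. (?t (fst z), ?t (snd z))) (off_diagonal N) (off_diagonal N)"
      using endo_inj_surj[OF finite_off_diagonal] unfolding bij_betw_def by blast
    from sum.reindex_bij_betw[OF this, of "\<lambda>(x, y). f x y"]
    show "(\<Sum>z\<in>off_diagonal N. f (\<tau> (Suc (fst z)) - 1) (\<tau> (Suc (snd z)) - 1))
        = (\<Sum>(x, y)\<in>off_diagonal N. f x y)"
      by simp
  qed
  also have "\<dots> = real (card ?P) * (real (N * (N - 1)) * distinct_pair_mean N f)"
    by (simp add: sum_off_diagonal N)
  finally have eq: "real (N * (N - 1)) * ?T
      = real (N * (N - 1)) * (real (card ?P) * distinct_pair_mean N f)"
    by (simp only: mult.left_commute[of "real (card ?P)"])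
  have "real (N * (N - 1)) \<noteq> 0" using N by simp
  then show ?thesis
    using eq by (rule mult_left_cancel[THEN iffD1])
qed

section \<open>The two sampling schemes\<close>
definition grid_point :: "nat \<Rightarrow> ('d::finite \<Rightarrow> nat) \<Rightarrow> real ^ 'd" where
  "grid_point N k = (\<chi> i. real (k i) / real N)"

lemma grid_point_eq_iff: "0 < N \<Longrightarrow> grid_point N k = grid_point N l \<longleftrightarrow> k = l"
  by (auto simp: grid_point_def vec_eq_iff fun_eq_iff)

lemma grid_point_image:
  fixes K :: "nat set"
  shows "grid_point N ` (Pi\<^sub>E UNIV (\<lambda>_. K)) = {x. \<forall>i. \<exists>k\<in>K. x $ i = real k / real N}"
proof (intro equalityI subsetI)
  fix x assume "x \<in> {x. \<forall>i. \<exists>k\<in>K. x $ i = real k / real N}"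
  then obtain k where "\<And>i. k i \<in> K" "\<And>i. x $ i = real (k i) / real N"
    by (auto simp: Bex_def) metis
  then show "x \<in> grid_point N ` (Pi\<^sub>E UNIV (\<lambda>_. K))"
    by (intro image_eqI[of _ _ k]) (auto simp: grid_point_def vec_eq_iff)
qed (fastforce simp: grid_point_def PiE_iff)

lemma card_grid_points:
  fixes K :: "nat set"
  assumes "0 < N" "finite K"
  shows "card {x :: real ^ 'd::finite. \<forall>i. \<exists>k\<in>K. x $ i = real k / real N} = card K ^ CARD('d)"
proof -
  have "inj_on (grid_point N) (Pi\<^sub>E UNIV (\<lambda>_ :: 'd. K))"
    using assms by (auto simp: inj_on_def grid_point_eq_iff)
  then show ?thesis
    unfolding grid_point_image[symmetric] using assms by (simp add: card_image card_PiE)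
qed

lemma borel_measurable_frac:
  fixes f :: "'a \<Rightarrow> real"
  assumes "f \<in> borel_measurable M"
  shows "(\<lambda>x. frac (f x)) \<in> borel_measurable M"
proof -
  have "(\<lambda>x. of_int \<lfloor>f x\<rfloor> :: real) \<in> borel_measurable M"
    using measurable_compose[OF assms borel_measurable_real_floor] by simp
  then show ?thesis
    unfolding frac_def using assms by (rule borel_measurable_diff[rotated])
qed

context prob_space
begin

text \<open>A configuration is a permutation \<open>\<sigma>\<close> and, for each coordinate, the numerators of the generator and
  of the shift. Keeping the last two together as \<open>h i\<close> makes the sum over configurations with fixed \<open>\<sigma>\<close>
  a product over the coordinates, to which \<open>lattice_pair_bij\<close> applies one coordinate at a time.\<close>
lemma rsj_lattice_cell_design:
  fixes p :: "nat \<Rightarrow> 'a \<Rightarrow> real ^ 'd::finite"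
  assumes N: "prime N" and rsj: "is_RSJ_rank1_lattice M N p"
  shows "cell_design M N p
    ({\<sigma>. \<sigma> permutes {1..N}} \<times> Pi\<^sub>E UNIV (\<lambda>_. {1..<N} \<times> {..<N}))
    (\<lambda>(\<sigma>, h) j i. ((\<sigma> j - 1) * fst (h i) + snd (h i)) mod N)"
proof -
  let ?P = "{\<sigma>. \<sigma> permutes {1..N}}" and ?Z = "{1..<N} \<times> {..<N}"
  let ?H = "Pi\<^sub>E (UNIV :: 'd set) (\<lambda>_. ?Z)"
  let ?A = "?P \<times> ?H"
  let ?c = "\<lambda>(\<sigma>, h) j i. ((\<sigma> j - 1) * fst (h i) + snd (h i)) mod N"
  have N2: "2 \<le> N" and N0: "0 < N"
    using N prime_ge_2_nat[of N] by auto
  have finP: "finite ?P" by (simp add: finite_permutations)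
  have idP: "id \<in> ?P" by (simp add: permutes_id)
  have finA: "finite ?A" using finP by (intro finite_cartesian_product finite_PiE) auto
  have "(id, \<lambda>_. (1, 0)) \<in> ?A" using idP N2 by (auto simp: PiE_iff)
  then have neA: "?A \<noteq> {}" by blast
  obtain g S :: "'a \<Rightarrow> real ^ 'd" and J :: "nat \<Rightarrow> 'a \<Rightarrow> real ^ 'd" and \<pi> :: "'a \<Rightarrow> nat \<Rightarrow> nat"
    where g: "uniform_on_finite M borel g (grid_nonzero N)"
      and S: "uniform_on_finite M borel S (grid N)"
      and J: "\<And>j. j \<in> {1..N} \<Longrightarrow> uniform_on M (J j) (cube (1 / real N))"
      and \<pi>: "uniform_on_finite M (count_space UNIV) \<pi> ?P"
      and indep: "indep_sets
          (\<lambda>k. case k of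
                 Generator \<Rightarrow> generated_events M borel g
               | Shift \<Rightarrow> generated_events M borel S
               | Jitter j \<Rightarrow> generated_events M borel (J j)
               | Permutation \<Rightarrow> generated_events M (count_space UNIV) \<pi>)
          ({Generator, Shift, Permutation} \<union> Jitter ` {1..N})"
      and p: "\<And>j \<omega>. j \<in> {1..N} \<Longrightarrow> \<omega> \<in> space M \<Longrightarrow>
          p j \<omega> = mod_one (mod_one ((real (\<pi> \<omega> j) - 1) *\<^sub>R g \<omega>) + S \<omega> + J j \<omega>)"
    using rsj unfolding is_RSJ_rank1_lattice_def by blast
  have [measurable]: "g \<in> borel_measurable M" "S \<in> borel_measurable M" "\<pi> \<in> measurable M (count_space UNIV)"
    using g S \<pi> by (auto simp: uniform_on_finite_def)
  have J_meas[measurable]: "J j \<in> borel_measurable M" if "j \<in> {1..N}" for j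
    using J[OF that] by (simp add: uniform_on_def)
  have coord: "p j \<omega> $ i = frac (frac ((real (\<pi> \<omega> j) - 1) * g \<omega> $ i) + S \<omega> $ i + J j \<omega> $ i)"
    if "j \<in> {1..N}" "\<omega> \<in> space M" for j \<omega> i
    using p[OF that] by (simp add: mod_one_def)
  have p_meas: "p j \<in> borel_measurable M" if j: "j \<in> {1..N}" for j
  proof -
    note J_meas[OF j, measurable]
    have "(\<lambda>\<omega>. real (\<pi> \<omega> j)) \<in> borel_measurable M"
      by (rule measurable_compose[of \<pi> M "count_space UNIV"]) auto
    moreover have "(\<lambda>\<omega>. g \<omega> $ i) \<in> borel_measurable M" "(\<lambda>\<omega>. S \<omega> $ i) \<in> borel_measurable M"
        "(\<lambda>\<omega>. J j \<omega> $ i) \<in> borel_measurable M" for i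
      using borel_measurable_vec_iff by fastforce+
    ultimately have "(\<lambda>\<omega>. frac (frac ((real (\<pi> \<omega> j) - 1) * g \<omega> $ i) + S \<omega> $ i + J j \<omega> $ i)) \<in> borel_measurable M" for i
      by (intro borel_measurable_frac borel_measurable_add borel_measurable_times borel_measurable_diff) auto
    then show ?thesis
      by (subst borel_measurable_vec_iff) (simp add: coord[OF j] cong: measurable_cong)
  qed
  define E where "E a = {\<omega>\<in>space M. \<pi> \<omega> = fst a \<and> g \<omega> = grid_point N (\<lambda>i. fst (snd a i))
      \<and> S \<omega> = grid_point N (\<lambda>i. snd (snd a i))}" for a :: "(nat \<Rightarrow> nat) \<times> ('d \<Rightarrow> nat \<times> nat)"
  have cardA: "card ?A = card ?P * (card (grid_nonzero N :: (real ^ 'd) set) * card (grid N :: (real ^ 'd) set))"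
    using card_grid_points[OF N0, of "{1..<N}", where 'd = 'd] card_grid_points[OF N0, of "{0..<N}", where 'd = 'd]
    by (simp add: grid_def grid_nonzero_def card_cartesian_product card_PiE power_mult_distrib)
  show ?thesis
  proof
    show "2 \<le> N" "finite ?A" "?A \<noteq> {}" by fact+
    show "p j \<in> borel_measurable M" if "j \<in> {1..N}" for j by (rule p_meas[OF that])
  next
    fix \<sigma> assume \<sigma>: "\<sigma> permutes {1..N}"
    let ?\<phi> = "map_prod (\<lambda>\<tau>. \<tau> \<circ> \<sigma>) id"
    have "bij_betw ?\<phi> ?A ?A"
      by (intro bij_betw_map_prod permutes_compose_bij[OF \<sigma>] bij_betw_id)
    then show "\<exists>\<phi>. bij_betw \<phi> ?A ?A \<and> (\<forall>a\<in>?A. \<forall>j\<in>{1..N}. ?c (\<phi> a) j = ?c a (\<sigma> j))"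
      by (intro exI[of _ ?\<phi>]) (auto simp: fun_eq_iff)
  next
    fix f :: "'d \<Rightarrow> nat \<Rightarrow> nat \<Rightarrow> real"
    have "(\<Sum>h\<in>?H. \<Prod>i\<in>UNIV. f i (?c (\<sigma>, h) 1 i) (?c (\<sigma>, h) 2 i))
        = real (card ?H) * (\<Prod>i\<in>UNIV. distinct_pair_mean N (f i))" if "\<sigma> \<in> ?P" for \<sigma>
    proof -
      let ?m = "\<sigma> 1 - 1" and ?n = "\<sigma> 2 - 1"
      have "\<sigma> permutes {1..N}" using that by simp
      then have "\<sigma> 1 \<in> {1..N}" "\<sigma> 2 \<in> {1..N}" "\<sigma> 1 \<noteq> \<sigma> 2"
        using N2 permutes_in_image[of \<sigma> "{1..N}"] permutes_inj[of \<sigma> "{1..N}"] by (auto dest: injD)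
      then have "?m < N" "?n < N" "?m \<noteq> ?n" by auto
      note bij = lattice_pair_bij[OF N this]
      have "(\<Sum>z\<in>?Z. f i ((?m * fst z + snd z) mod N) ((?n * fst z + snd z) mod N))
          = real (N * (N - 1)) * distinct_pair_mean N (f i)" for i
        using sum.reindex_bij_betw[OF bij, of "\<lambda>(x, y). f i x y"] sum_off_diagonal[OF N2, of "f i"]
        by (simp add: split_beta)
      then have "(\<Prod>i\<in>UNIV. \<Sum>z\<in>?Z. f i ((?m * fst z + snd z) mod N) ((?n * fst z + snd z) mod N))
          = real (card ?H) * (\<Prod>i\<in>UNIV. distinct_pair_mean N (f i))"
        by (simp add: prod.distrib card_PiE card_cartesian_product mult.commute)
      then show ?thesis
        by (subst (asm) prod_sum_PiE) auto
    qed
    then show "(\<Sum>a\<in>?A. \<Prod>i\<in>UNIV. f i (?c a 1 i) (?c a 2 i))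
        = real (card ?A) * (\<Prod>i\<in>UNIV. distinct_pair_mean N (f i))"
      by (subst sum.cartesian_product') (simp add: card_cartesian_product)
  next
    fix B :: "nat \<Rightarrow> 'd \<Rightarrow> real set"
    assume B: "\<And>j i. B j i \<in> sets borel"
    let ?F = "{\<omega>\<in>space M. \<forall>j\<in>{1..N}. \<forall>i. p j \<omega> $ i \<in> B j i}"
    let ?I = "{Generator, Shift, Permutation}"
    let ?w = "\<lambda>a. \<Prod>j\<in>{1..N}. \<Prod>i\<in>UNIV. cell_mass N (?c a j i) (B j i)"
    have F: "?F \<in> events"
    proof -
      have "{\<omega>\<in>space M. p j \<omega> $ i \<in> B j i} \<in> events" if "j \<in> {1..N}" for j i
        using p_meas[OF that] B[of j i] by (auto simp: borel_measurable_vec_iff intro: measurable_sets_Collect)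
      then show ?thesis
        by (intro sets.sets_Collect_finite_All sets.sets_Collect_finite_All') auto
    qed
    have E_events: "E a \<in> events" for a
      unfolding E_def by measurable
    have split: "prob (E a) = 1 / real (card ?A) \<and> prob (?F \<inter> E a) = prob (E a) * ?w a"
      if a_mem: "a \<in> ?A" for a
    proof -
      obtain \<sigma> h where a: "a = (\<sigma>, h)" and \<sigma>: "\<sigma> permutes {1..N}" and h: "h \<in> ?H"
        using a_mem by auto
      let ?g = "grid_point N (\<lambda>i. fst (h i))" and ?s = "grid_point N (\<lambda>i. snd (h i))"
      have g_mem: "?g \<in> grid_nonzero N" and s_mem: "?s \<in> grid N"
        using h by (fastforce simp: grid_def grid_nonzero_def grid_point_def PiE_iff mem_Times_iff)+
      \<comment> \<open>On \<open>E a\<close> the point is a function of its jitter alone; this is the preimage of the target set.\<close>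
      define B' where "B' j i = {t. frac (frac (real (\<sigma> j - 1) * ?g $ i) + ?s $ i + t) \<in> B j i}" for j i
      have B': "B' j i \<in> sets borel" for j i
      proof -
        have "(\<lambda>t. frac (frac (real (\<sigma> j - 1) * ?g $ i) + ?s $ i + t)) \<in> borel_measurable borel"
          by (intro borel_measurable_frac borel_measurable_add) auto
        from measurable_sets[OF this B[of j i]] show ?thesis
          by (simp add: B'_def vimage_def)
      qed
      define X where "X k = (case k of
          Generator \<Rightarrow> {\<omega>\<in>space M. g \<omega> = ?g}
        | Shift \<Rightarrow> {\<omega>\<in>space M. S \<omega> = ?s}
        | Jitter j \<Rightarrow> {\<omega>\<in>space M. \<forall>i. J j \<omega> $ i \<in> B' j i}
        | Permutation \<Rightarrow> {\<omega>\<in>space M. \<pi> \<omega> = \<sigma>})" for k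
      have X_mem: "X k \<in> (case k of
                 Generator \<Rightarrow> generated_events M borel g
               | Shift \<Rightarrow> generated_events M borel S
               | Jitter j \<Rightarrow> generated_events M borel (J j)
               | Permutation \<Rightarrow> generated_events M (count_space UNIV) \<pi>)" for k
      proof (cases k)
        case Generator
        then show ?thesis
          by (auto simp: X_def generated_events_def intro!: exI[of _ "{?g}"])
      next
        case Shift
        then show ?thesis
          by (auto simp: X_def generated_events_def intro!: exI[of _ "{?s}"])
      next
        case (Jitter j)
        then show ?thesis
          using sets_product_box[of "B' j"] B'
          by (auto simp: X_def generated_events_def intro!: exI[of _ "{x. \<forall>i. x $ i \<in> B' j i}"])
      next
        case Permutation
        then show ?thesis
          by (auto simp: X_def generated_events_def intro!: exI[of _ "{\<sigma>}"])
      qed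
      have E_eq: "E a = (\<Inter>k\<in>?I. X k)"
        by (auto simp: a E_def X_def)
      have FE_eq: "?F \<inter> E a = (\<Inter>k\<in>?I \<union> Jitter ` {1..N}. X k)"
      proof -
        have "real (\<sigma> j - 1) = real (\<sigma> j) - 1" if "j \<in> {1..N}" for j
          using permutes_in_image[OF \<sigma>, of j] that by (simp add: of_nat_diff)
        then have "(\<forall>j\<in>{1..N}. \<forall>i. p j \<omega> $ i \<in> B j i) \<longleftrightarrow> (\<forall>j\<in>{1..N}. \<forall>i. J j \<omega> $ i \<in> B' j i)"
          if "\<omega> \<in> E a" for \<omega>
          using that by (auto simp: coord E_def a B'_def)
        then have "?F \<inter> E a = {\<omega>\<in>E a. \<forall>j\<in>{1..N}. \<forall>i. J j \<omega> $ i \<in> B' j i}"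
          by (auto simp: E_def)
        then show ?thesis
          by (auto simp: a E_def X_def)
      qed
      have prod_E: "prob (E a) = (\<Prod>k\<in>?I. prob (X k))"
        unfolding E_eq by (rule indep_setsD[OF indep]) (use X_mem in auto)
      also have "\<dots> = 1 / real (card ?A)"
        using g S \<pi> g_mem s_mem \<sigma> unfolding cardA
        by (simp add: X_def uniform_on_finite_def)
      finally have 1: "prob (E a) = 1 / real (card ?A)" .
      have "prob (?F \<inter> E a) = (\<Prod>k\<in>?I \<union> Jitter ` {1..N}. prob (X k))"
        unfolding FE_eq by (rule indep_setsD[OF indep]) (use X_mem in auto)
      also have "\<dots> = prob (E a) * (\<Prod>k\<in>Jitter ` {1..N}. prob (X k))"
        unfolding prod_E by (rule prod.union_disjoint) auto
      also have "(\<Prod>k\<in>Jitter ` {1..N}. prob (X k)) = (\<Prod>j\<in>{1..N}. prob (X (Jitter j)))"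
        by (simp add: prod.reindex inj_on_def)
      also have "\<dots> = ?w a"
      proof (rule prod.cong[OF refl])
        fix j assume j: "j \<in> {1..N}"
        have "prob (X (Jitter j)) = (\<Prod>i\<in>UNIV. measure lborel (B' j i \<inter> {0..<1 / real N}) / (1 / real N))"
          using prob_uniform_cube[OF J[OF j], of "B' j"] B' N0 by (simp add: X_def)
        also have "\<dots> = (\<Prod>i\<in>UNIV. cell_mass N (?c a j i) (B j i))"
        proof (rule prod.cong[OF refl])
          fix i
          have "B' j i \<inter> {0..<1 / real N} = {t. real (?c a j i) / real N + t \<in> B j i} \<inter> {0..<1 / real N}"
            using frac_lattice_point[OF N0, of _ "\<sigma> j - 1" "fst (h i)" "snd (h i)"]
            by (auto simp: a B'_def grid_point_def)
          then show "measure lborel (B' j i \<inter> {0..<1 / real N}) / (1 / real N)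
              = cell_mass N (?c a j i) (B j i)"
            using cell_mass_jitter[OF N0 B] by simp
        qed
        finally show "prob (X (Jitter j)) = (\<Prod>i\<in>UNIV. cell_mass N (?c a j i) (B j i))" .
      qed
      finally show ?thesis using 1 by simp
    qed
    show "\<P>(\<omega> in M. \<forall>j\<in>{1..N}. \<forall>i. p j \<omega> $ i \<in> B j i)
        = (\<Sum>a\<in>?A. \<Prod>j\<in>{1..N}. \<Prod>i\<in>UNIV. cell_mass N (?c a j i) (B j i)) / real (card ?A)"
    proof (rule prob_eq_mean_over_cases[where E = E])
      show "finite ?A" "?A \<noteq> {}" by fact+
      show "disjoint_family_on E ?A"
        using N0 by (auto simp: disjoint_family_on_def E_def grid_point_eq_iff fun_eq_iff prod_eq_iff)
    qed (use E_events F split in auto)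
  qed
qed

text \<open>The cell in coordinate \<open>i\<close> is \<open>\<tau> i j - 1\<close> because permutations act on \<open>{1..N}\<close> while cells are
  counted from \<open>0\<close>.\<close>
lemma latin_hypercube_cell_design:
  fixes p :: "nat \<Rightarrow> 'a \<Rightarrow> real ^ 'd::finite"
  assumes N: "2 \<le> N" and lhs: "is_latin_hypercube_sampling M N p"
  shows "cell_design M N p (Pi\<^sub>E UNIV (\<lambda>_. {\<sigma>. \<sigma> permutes {1..N}})) (\<lambda>\<tau> j i. \<tau> i j - 1)"
proof -
  let ?P = "{\<sigma>. \<sigma> permutes {1..N}}"
  let ?A = "Pi\<^sub>E (UNIV :: 'd set) (\<lambda>_. ?P)"
  let ?c = "\<lambda>(\<tau> :: 'd \<Rightarrow> nat \<Rightarrow> nat) j i. \<tau> i j - 1"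
  have N0: "0 < N" using N by simp
  have finP: "finite ?P" by (simp add: finite_permutations)
  have finA: "finite ?A" using finP by (intro finite_PiE) auto
  have "(\<lambda>_. id) \<in> ?A" by (simp add: PiE_iff permutes_id)
  then have neA: "?A \<noteq> {}" by blast
  obtain \<pi> :: "'d \<Rightarrow> 'a \<Rightarrow> nat \<Rightarrow> nat" and U :: "nat \<Rightarrow> 'd \<Rightarrow> 'a \<Rightarrow> real"
    where \<pi>: "\<And>i. uniform_on_finite M (count_space UNIV) (\<pi> i) ?P"
      and U: "\<And>j i. j \<in> {1..N} \<Longrightarrow> uniform_on M (U j i) {0..<1}"
      and indep: "indep_sets
          (\<lambda>k. case k of
                 Coordinate_Permutation i \<Rightarrow> generated_events M (count_space UNIV) (\<pi> i)
               | Offset j i \<Rightarrow> generated_events M borel (U j i))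
          (range Coordinate_Permutation \<union> {Offset j i | j i. j \<in> {1..N}})"
      and p: "\<And>j \<omega> i. j \<in> {1..N} \<Longrightarrow> \<omega> \<in> space M \<Longrightarrow>
          p j \<omega> $ i = (real (\<pi> i \<omega> j) - U j i \<omega>) / real N"
    using lhs unfolding is_latin_hypercube_sampling_def by blast
  have \<pi>_meas[measurable]: "\<pi> i \<in> measurable M (count_space UNIV)" for i
    using \<pi>[of i] by (auto simp: uniform_on_finite_def)
  have U_meas: "U j i \<in> borel_measurable M" if "j \<in> {1..N}" for j i
    using U[OF that] by (simp add: uniform_on_def)
  have p_meas: "p j \<in> borel_measurable M" if j: "j \<in> {1..N}" for j
  proof -
    note U_meas[OF j, measurable]
    have "(\<lambda>\<omega>. real (\<pi> i \<omega> j)) \<in> borel_measurable M" for i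
      by (rule measurable_compose[of "\<pi> i" M "count_space UNIV"]) auto
    then have "(\<lambda>\<omega>. (real (\<pi> i \<omega> j) - U j i \<omega>) / real N) \<in> borel_measurable M" for i
      by measurable
    then show ?thesis
      by (subst borel_measurable_vec_iff) (simp add: p[OF j] cong: measurable_cong)
  qed
  define E where "E \<tau> = {\<omega>\<in>space M. \<forall>i. \<pi> i \<omega> = \<tau> i}" for \<tau>
  show ?thesis
  proof
    show "2 \<le> N" "finite ?A" "?A \<noteq> {}" by fact+
    show "p j \<in> borel_measurable M" if "j \<in> {1..N}" for j by (rule p_meas[OF that])
  next
    fix \<sigma> assume \<sigma>: "\<sigma> permutes {1..N}"
    let ?\<phi> = "\<lambda>(\<tau> :: 'd \<Rightarrow> nat \<Rightarrow> nat) i. \<tau> i \<circ> \<sigma>"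
    have "bij_betw ?\<phi> ?A ?A"
    proof (rule bij_betwI[where g = "\<lambda>\<tau> i. \<tau> i \<circ> inv \<sigma>"])
      show "?\<phi> \<in> ?A \<rightarrow> ?A"
        using \<sigma> by (auto intro: permutes_compose simp: PiE_iff)
      show "(\<lambda>\<tau> i. \<tau> i \<circ> inv \<sigma>) \<in> ?A \<rightarrow> ?A"
        using permutes_inv[OF \<sigma>] by (auto intro: permutes_compose simp: PiE_iff)
    qed (auto simp: comp_assoc permutes_inv_o[OF \<sigma>])
    then show "\<exists>\<phi>. bij_betw \<phi> ?A ?A \<and> (\<forall>a\<in>?A. \<forall>j\<in>{1..N}. ?c (\<phi> a) j = ?c a (\<sigma> j))"
      by (intro exI[of _ ?\<phi>]) auto
  next
    fix f :: "'d \<Rightarrow> nat \<Rightarrow> nat \<Rightarrow> real"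
    have "(\<Sum>\<tau>\<in>?A. \<Prod>i\<in>UNIV. f i (?c \<tau> 1 i) (?c \<tau> 2 i))
        = (\<Prod>i\<in>UNIV. \<Sum>\<tau>\<in>?P. f i (\<tau> 1 - 1) (\<tau> 2 - 1))"
      using finP by (subst prod_sum_PiE) auto
    also have "\<dots> = real (card ?A) * (\<Prod>i\<in>UNIV. distinct_pair_mean N (f i))"
      unfolding sum_permutations_pair[OF N] by (simp add: prod.distrib card_PiE)
    finally show "(\<Sum>\<tau>\<in>?A. \<Prod>i\<in>UNIV. f i (?c \<tau> 1 i) (?c \<tau> 2 i))
        = real (card ?A) * (\<Prod>i\<in>UNIV. distinct_pair_mean N (f i))" .
  next
    fix B :: "nat \<Rightarrow> 'd \<Rightarrow> real set"
    assume B: "\<And>j i. B j i \<in> sets borel"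
    let ?F = "{\<omega>\<in>space M. \<forall>j\<in>{1..N}. \<forall>i. p j \<omega> $ i \<in> B j i}"
    let ?I = "range Coordinate_Permutation :: 'd lhs_index set"
    let ?O = "{Offset j i | j i. j \<in> {1..N}} :: 'd lhs_index set"
    let ?w = "\<lambda>a. \<Prod>j\<in>{1..N}. \<Prod>i\<in>UNIV. cell_mass N (?c a j i) (B j i)"
    have O_image: "?O = (\<lambda>(j, i). Offset j i) ` ({1..N} \<times> UNIV)"
      by auto
    have finO: "finite ?O"
      unfolding O_image by (intro finite_imageI finite_cartesian_product) auto
    have F: "?F \<in> events"
    proof -
      have "{\<omega>\<in>space M. p j \<omega> $ i \<in> B j i} \<in> events" if "j \<in> {1..N}" for j i
        using p_meas[OF that] B[of j i] by (auto simp: borel_measurable_vec_iff intro: measurable_sets_Collect)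
      then show ?thesis
        by (intro sets.sets_Collect_finite_All sets.sets_Collect_finite_All') auto
    qed
    have E_events: "E \<tau> \<in> events" for \<tau>
      unfolding E_def by measurable
    have split: "prob (E \<tau>) = 1 / real (card ?A) \<and> prob (?F \<inter> E \<tau>) = prob (E \<tau>) * ?w \<tau>"
      if \<tau>: "\<tau> \<in> ?A" for \<tau>
    proof -
      have perm: "\<tau> i permutes {1..N}" for i using \<tau> by (auto simp: PiE_iff)
      define B' where "B' j i = {t. (real (\<tau> i j) - t) / real N \<in> B j i}" for j i
      have B': "B' j i \<in> sets borel" for j i
      proof -
        have "(\<lambda>t. (real (\<tau> i j) - t) / real N) \<in> borel_measurable borel"
          by measurable
        from measurable_sets[OF this B[of j i]] show ?thesis
          by (simp add: B'_def vimage_def)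
      qed
      define X where "X k = (case k of
          Coordinate_Permutation i \<Rightarrow> {\<omega>\<in>space M. \<pi> i \<omega> = \<tau> i}
        | Offset j i \<Rightarrow> {\<omega>\<in>space M. U j i \<omega> \<in> B' j i})" for k
      have X_mem: "X k \<in> (case k of
                 Coordinate_Permutation i \<Rightarrow> generated_events M (count_space UNIV) (\<pi> i)
               | Offset j i \<Rightarrow> generated_events M borel (U j i))" for k
      proof (cases k)
        case (Coordinate_Permutation i)
        then show ?thesis
          by (auto simp: X_def generated_events_def intro!: exI[of _ "{\<tau> i}"])
      next
        case (Offset j i)
        then show ?thesis
          using B'[of j i] by (auto simp: X_def generated_events_def intro!: exI[of _ "B' j i"])
      qed
      have E_eq: "E \<tau> = (\<Inter>k\<in>?I. X k)"
        by (auto simp: E_def X_def)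
      have FE_eq: "?F \<inter> E \<tau> = (\<Inter>k\<in>?I \<union> ?O. X k)"
      proof -
        have "(\<forall>j\<in>{1..N}. \<forall>i. p j \<omega> $ i \<in> B j i) \<longleftrightarrow> (\<forall>j\<in>{1..N}. \<forall>i. U j i \<omega> \<in> B' j i)"
          if "\<omega> \<in> E \<tau>" for \<omega>
          using that by (auto simp: p E_def B'_def)
        then have "?F \<inter> E \<tau> = {\<omega>\<in>E \<tau>. \<forall>j\<in>{1..N}. \<forall>i. U j i \<omega> \<in> B' j i}"
          by (auto simp: E_def)
        also have "\<dots> = (\<Inter>i. X (Coordinate_Permutation i)) \<inter> (\<Inter>j\<in>{1..N}. \<Inter>i. X (Offset j i))"
          using N0 by (auto simp: E_def X_def)
        also have "\<dots> = (\<Inter>k\<in>?I \<union> ?O. X k)"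
          unfolding O_image by auto
        finally show ?thesis .
      qed
      have prod_E: "prob (E \<tau>) = (\<Prod>k\<in>?I. prob (X k))"
        unfolding E_eq by (rule indep_setsD[OF indep]) (use X_mem in auto)
      also have "\<dots> = (\<Prod>i\<in>(UNIV :: 'd set). prob (X (Coordinate_Permutation i)))"
        by (simp add: prod.reindex inj_on_def)
      also have "\<dots> = (\<Prod>i\<in>(UNIV :: 'd set). 1 / real (card ?P))"
        using \<pi> perm by (intro prod.cong) (auto simp: X_def uniform_on_finite_def)
      also have "\<dots> = 1 / real (card ?A)"
        by (simp add: card_PiE power_one_over)
      finally have 1: "prob (E \<tau>) = 1 / real (card ?A)" .
      have "prob (?F \<inter> E \<tau>) = (\<Prod>k\<in>?I \<union> ?O. prob (X k))"
        unfolding FE_eq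
      proof (rule indep_setsD[OF indep])
        show "finite (?I \<union> ?O)"
          by (rule finite_UnI[OF _ finO]) simp
      qed (use X_mem in auto)
      also have "\<dots> = prob (E \<tau>) * (\<Prod>k\<in>?O. prob (X k))"
        unfolding prod_E by (rule prod.union_disjoint[OF _ finO]) auto
      also have "(\<Prod>k\<in>?O. prob (X k)) = (\<Prod>j\<in>{1..N}. \<Prod>i\<in>UNIV. prob (X (Offset j i)))"
        unfolding O_image by (subst prod.reindex) (auto simp: inj_on_def prod.cartesian_product split_beta)
      also have "\<dots> = ?w \<tau>"
      proof (intro prod.cong refl)
        fix j i assume j: "j \<in> {1..N}"
        have "prob (X (Offset j i)) = measure (distr M borel (U j i)) (B' j i)"
          using B'[of j i] U_meas[OF j] by (simp add: X_def measure_distr vimage_def Int_def conj_commute)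
        also have "\<dots> = measure lborel (B' j i \<inter> {0..<1})"
          using U[OF j] B'[of j i] by (simp add: uniform_on_def Int_commute)
        also have "\<dots> = cell_mass N (?c \<tau> j i) (B j i)"
        proof -
          have "Suc (\<tau> i j - 1) = \<tau> i j"
            using permutes_in_image[OF perm[of i], of j] j by simp
          then show ?thesis
            using cell_mass_reflected_offset[OF N0 B[of j i], of "\<tau> i j - 1"] by (simp only: B'_def)
        qed
        finally show "prob (X (Offset j i)) = cell_mass N (?c \<tau> j i) (B j i)" .
      qed
      finally show ?thesis using 1 by simp
    qed
    show "\<P>(\<omega> in M. \<forall>j\<in>{1..N}. \<forall>i. p j \<omega> $ i \<in> B j i)
        = (\<Sum>a\<in>?A. \<Prod>j\<in>{1..N}. \<Prod>i\<in>UNIV. cell_mass N (?c a j i) (B j i)) / real (card ?A)"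
    proof (rule prob_eq_mean_over_cases[where E = E])
      show "finite ?A" "?A \<noteq> {}" by fact+
      show "disjoint_family_on E ?A"
        by (auto simp: disjoint_family_on_def E_def fun_eq_iff)
    qed (use E_events F split in auto)
  qed
qed

end

theorem theorem3p4:
  fixes M :: "'a measure" and N :: nat and p :: "nat \<Rightarrow> 'a \<Rightarrow> real ^ 'd::finite"
  assumes "prob_space M"
    and "N \<ge> 2"
    and "(prime N \<and> is_RSJ_rank1_lattice M N p) \<or> is_latin_hypercube_sampling M N p"
  shows "(\<forall>Q\<in>boxes_at_one. \<forall>R\<in>boxes_at_one.
            \<P>(\<omega> in M. p 1 \<omega> \<in> Q \<and> p 2 \<omega> \<in> R)
              \<le> \<P>(\<omega> in M. p 1 \<omega> \<in> Q) * \<P>(\<omega> in M. p 2 \<omega> \<in> R)) \<and>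
         pairwise_negatively_dependent M N p \<and>
         coordinatewise_independent_NQD M N p"
proof -
  have "pairwise_negatively_dependent M N p \<and> coordinatewise_independent_NQD M N p"
    using assms(3)
  proof
    assume rsj: "prime N \<and> is_RSJ_rank1_lattice M N p"
    note design = prob_space.rsj_lattice_cell_design[OF assms(1) conjunct1[OF rsj] conjunct2[OF rsj]]
    show ?thesis
      by (rule conjI[OF cell_design.pairwise_negatively_dependent[OF design]
            cell_design.coordinatewise_independent_NQD[OF design]])
  next
    assume lhs: "is_latin_hypercube_sampling M N p"
    note design = prob_space.latin_hypercube_cell_design[OF assms(1,2) lhs]
    show ?thesis
      by (rule conjI[OF cell_design.pairwise_negatively_dependent[OF design]
            cell_design.coordinatewise_independent_NQD[OF design]])
  qed
  moreover from this have "\<forall>Q\<in>boxes_at_one. \<forall>R\<in>boxes_at_one.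
            \<P>(\<omega> in M. p 1 \<omega> \<in> Q \<and> p 2 \<omega> \<in> R)
              \<le> \<P>(\<omega> in M. p 1 \<omega> \<in> Q) * \<P>(\<omega> in M. p 2 \<omega> \<in> R)"
    unfolding pairwise_negatively_dependent_def by (elim conjE)
  ultimately show ?thesis by (rule conjI[rotated])
qed

end
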